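(* Suppose that $\theta\in\mathcal{L}^0_T$ and that $\mathcal{A}$ is closed in $\mathcal{L}^0_T$ and arbitrage-free. The following are equivalent: (i) there is a self-financing process $\eta$ such that $\theta\le\eta_T$ (componentwise a.s.), i.e. $\theta\in\mathcal{A}$; (ii) for every consistent price process $Z$ such that the negative part $(\theta\cdot Z_T)_-$ of the random variable $\theta\cdot Z_T$ is integrable, we have $\mathbb{E}[\theta\cdot Z_T]\le 0$.
   Context: Let $(\Omega,\mathcal{F},(\mathcal{F}_t)_{t=0,1,\dots,T},\mathbb{P})$ be a filtered probability space and $d\ge 1$ an integer. $\mathcal{L}^0_t$ is the space of $\mathbb{R}^d$-valued $\mathcal{F}_t$-measurable random variables (identified when a.s. equal) with the topology of convergence in probability, and $\mathcal{L}^{0,+}_t$ the subset of those with non-negative components. For a (suitably measurable) random set $S$, $\mathcal{L}^0(S;\mathcal{F}_t)$ is the set of $\mathcal{F}_t$-measurable random variables taking values a.s. in $S$. A $d\times d$ real matrix $\Pi$ is a bid-ask matrix if $\Pi^{ij}>0$, $\Pi^{ii}=1$ and $\Pi^{ij}\Pi^{jk}\ge\Pi^{ik}$ for all $i,j,k$. A bid-ask process is an adapted $\mathbb{R}^{d\times d}$-valued process $(\pi_t)_{t=0,\dots,T}$ with each $\pi_t$ a bid-ask matrix; fix one, $\pi$. For a bid-ask matrix $\Pi$ let $K(\Pi)\subset\mathbb{R}^d$ be the convex cone spanned by the canonical basis vectors $e_i$ ($1\le i\le d$) and the vectors $\Pi^{ij}e_i-e_j$ ($1\le i,j\le d$). Put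 $-\mathcal{K}_t:=\mathcal{L}^0(-K(\pi_t);\mathcal{F}_t)$ and $\mathcal{A}:=(-\mathcal{K}_0)+\dots+(-\mathcal{K}_T)\subseteq\mathcal{L}^0_T$. $\mathcal{A}$ is arbitrage-free if $\mathcal{A}\cap\mathcal{L}^{0,+}_T=\{0\}$. A self-financing process is an adapted $\mathbb{R}^d$-valued process $\eta=(\eta_t)_{t=0,\dots,T}$ with $\eta_t-\eta_{t-1}\in-\mathcal{K}_t$ for $t=0,\dots,T$, where $\eta_{-1}:=0$. A consistent price process is an $\mathbb{R}^d$-valued martingale $Z=(Z_t)_{t=0,\dots,T}$ such that, for each $t$, $Z_t$ takes values a.s. in $M_t^*\setminus\{0\}$, where $M_t=-K(\pi_t)$ and, for a cone $M\subseteq\mathbb{R}^d$, $M^*=\{y\in\mathbb{R}^d:\ y\cdot x\le 0\text{ for all }x\in M\}$ is its polar. *)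

theory Defs
  imports "HOL-Probability.Probability"
begin

text \<open>Random variables are represented by functions on the sample space rather than by their
  classes modulo almost sure equality. The sets of random variables defined below are all
  invariant under almost sure equality of measurable functions.\<close>

definition filtered_prob_space :: "'a measure \<Rightarrow> (nat \<Rightarrow> 'a measure) \<Rightarrow> nat \<Rightarrow> bool" where
  "filtered_prob_space M F T \<longleftrightarrow>
     prob_space M \<and> (\<forall>t\<le>T. subalgebra M (F t)) \<and> (\<forall>s t. s \<le> t \<and> t \<le> T \<longrightarrow> sets (F s) \<subseteq> sets (F t))"

definition adapted :: "(nat \<Rightarrow> 'a measure) \<Rightarrow> nat \<Rightarrow> (nat \<Rightarrow> 'a \<Rightarrow> 'b::topological_space) \<Rightarrow> bool" where
  "adapted F T X \<longleftrightarrow> (\<forall>t\<le>T. X t \<in> borel_measurable (F t))"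


subsection \<open>The space of random variables with convergence in probability\<close>

text \<open>A basis of neighbourhoods of \<open>X\<close> is given by the sets of those \<open>Y\<close> with
  \<open>P (norm (X - Y) > e) < e\<close>, for \<open>e > 0\<close>. As functions are not identified when almost surely
  equal, this topology is not Hausdorff; its closed sets are automatically invariant under almost
  sure equality.\<close>

definition L0_topology :: "'a measure \<Rightarrow> 'a measure \<Rightarrow> ('a \<Rightarrow> 'b::euclidean_space) topology" where
  "L0_topology M G = topology (\<lambda>U. U \<subseteq> borel_measurable G \<and>
     (\<forall>X\<in>U. \<exists>e>0. \<forall>Y\<in>borel_measurable G.
        measure M {\<omega>\<in>space M. e < norm (X \<omega> - Y \<omega>)} < e \<longrightarrow> Y \<in> U))"

lemma openin_L0_topology:
  fixes U :: "('a \<Rightarrow> 'b::euclidean_space) set"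
  assumes "prob_space M" "subalgebra M G"
  shows "openin (L0_topology M G) U \<longleftrightarrow> U \<subseteq> borel_measurable G \<and>
     (\<forall>X\<in>U. \<exists>e>0. \<forall>Y\<in>borel_measurable G.
        measure M {\<omega>\<in>space M. e < norm (X \<omega> - Y \<omega>)} < e \<longrightarrow> Y \<in> U)"
proof -
  interpret prob_space M by fact
  define P where "P e X Y = measure M {\<omega>\<in>space M. e < norm (X \<omega> - Y \<omega>)}"
    for e and X Y :: "'a \<Rightarrow> 'b"
  define O' where "O' U \<longleftrightarrow> U \<subseteq> borel_measurable G \<and>
     (\<forall>X\<in>U. \<exists>e>0. \<forall>Y\<in>borel_measurable G. P e X Y < e \<longrightarrow> Y \<in> U)" for U
  have mono: "P e X Y \<le> P d X Y"
    if "d \<le> e" and XY: "X \<in> borel_measurable G" "Y \<in> borel_measurable G" for d e X Y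
  proof -
    have [measurable]: "X \<in> borel_measurable M" "Y \<in> borel_measurable M"
      using XY measurable_from_subalg[OF assms(2)] by auto
    show ?thesis
      unfolding P_def by (rule finite_measure_mono) (use that in auto)
  qed
  have "istopology O'"
    unfolding istopology_def
  proof (intro conjI allI impI)
    fix S V assume S: "O' S" and V: "O' V"
    show "O' (S \<inter> V)"
      unfolding O'_def
    proof (intro conjI ballI)
      show "S \<inter> V \<subseteq> borel_measurable G" using S by (auto simp: O'_def)
      fix X assume X: "X \<in> S \<inter> V"
      hence XG: "X \<in> borel_measurable G" using S by (auto simp: O'_def)
      obtain a where a: "a > 0" "\<And>Y. Y \<in> borel_measurable G \<Longrightarrow> P a X Y < a \<Longrightarrow> Y \<in> S"
        using S X unfolding O'_def by blast
      obtain b where b: "b > 0" "\<And>Y. Y \<in> borel_measurable G \<Longrightarrow> P b X Y < b \<Longrightarrow> Y \<in> V"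
        using V X unfolding O'_def by blast
      have "Y \<in> S \<inter> V" if Y: "Y \<in> borel_measurable G" "P (min a b) X Y < min a b" for Y
        using a(2)[OF Y(1)] b(2)[OF Y(1)] Y(2)
          mono[of "min a b" a X Y] mono[of "min a b" b X Y] XG Y(1) by auto
      thus "\<exists>e>0. \<forall>Y\<in>borel_measurable G. P e X Y < e \<longrightarrow> Y \<in> S \<inter> V"
        using a(1) b(1) by (intro exI[of _ "min a b"]) auto
    qed
  next
    fix \<U> assume U: "\<forall>U\<in>\<U>. O' U"
    show "O' (\<Union>\<U>)"
      unfolding O'_def
    proof (intro conjI ballI)
      show "\<Union>\<U> \<subseteq> borel_measurable G"
        using U unfolding O'_def by blast
      fix X assume "X \<in> \<Union>\<U>"
      then obtain U where XU: "X \<in> U" "U \<in> \<U>" by blast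
      then obtain e where "e > 0" "\<forall>Y\<in>borel_measurable G. P e X Y < e \<longrightarrow> Y \<in> U"
        using U unfolding O'_def by blast
      thus "\<exists>e>0. \<forall>Y\<in>borel_measurable G. P e X Y < e \<longrightarrow> Y \<in> \<Union>\<U>"
        using XU by blast
    qed
  qed
  hence "openin (topology O') = O'" by (rule topology_inverse')
  moreover have "L0_topology M G = topology O'"
    unfolding L0_topology_def O'_def P_def by (rule refl)
  ultimately show ?thesis
    by (simp add: O'_def P_def)
qed

lemma topspace_L0_topology:
  assumes "prob_space M" "subalgebra M G"
  shows "topspace (L0_topology M G) = borel_measurable G"
proof (rule antisym)
  show "topspace (L0_topology M G) \<subseteq> borel_measurable G"
    using openin_topspace[of "L0_topology M G"] unfolding openin_L0_topology[OF assms] by blast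
  have "openin (L0_topology M G) (borel_measurable G)"
    unfolding openin_L0_topology[OF assms] using zero_less_one by blast
  thus "borel_measurable G \<subseteq> topspace (L0_topology M G)" by (rule openin_subset)
qed

lemma closedin_L0_topology_iff:
  fixes A :: "('a \<Rightarrow> 'b::euclidean_space) set"
  assumes "prob_space M" "subalgebra M G"
  shows "closedin (L0_topology M G) A \<longleftrightarrow> A \<subseteq> borel_measurable G \<and>
    (\<forall>Y X. range Y \<subseteq> A \<and> X \<in> borel_measurable G \<and>
      (\<forall>e>0. (\<lambda>n. measure M {\<omega>\<in>space M. e < norm (X \<omega> - Y n \<omega>)}) \<longlonglongrightarrow> 0) \<longrightarrow> X \<in> A)"
    (is "?L \<longleftrightarrow> ?R")
proof
  assume L: ?L
  hence sub: "A \<subseteq> borel_measurable G"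
    using closedin_subset topspace_L0_topology[OF assms] by blast
  have op: "openin (L0_topology M G) (borel_measurable G - A)"
    using L by (simp add: closedin_def topspace_L0_topology[OF assms])
  show ?R
  proof (intro conjI sub allI impI; elim conjE)
    fix Y :: "nat \<Rightarrow> 'a \<Rightarrow> 'b" and X
    assume Y: "range Y \<subseteq> A" and X: "X \<in> borel_measurable G"
      and lim: "\<forall>e>0. (\<lambda>n. measure M {\<omega>\<in>space M. e < norm (X \<omega> - Y n \<omega>)}) \<longlonglongrightarrow> 0"
    show "X \<in> A"
    proof (rule ccontr)
      assume "X \<notin> A"
      then obtain e where e: "e > 0" "\<forall>Y\<in>borel_measurable G.
          measure M {\<omega>\<in>space M. e < norm (X \<omega> - Y \<omega>)} < e \<longrightarrow> Y \<in> borel_measurable G - A"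
        using op X unfolding openin_L0_topology[OF assms] by blast
      have "\<forall>\<^sub>F n in sequentially. measure M {\<omega>\<in>space M. e < norm (X \<omega> - Y n \<omega>)} < e"
        using lim e(1) order_tendstoD(2) by blast
      then obtain n where "measure M {\<omega>\<in>space M. e < norm (X \<omega> - Y n \<omega>)} < e"
        by (meson eventually_sequentially le_refl)
      thus False using e(2) Y sub by blast
    qed
  qed
next
  assume R: ?R
  interpret prob_space M by fact
  have sub: "A \<subseteq> borel_measurable G" using R by simp
  have meas: "{\<omega>\<in>space M. e < norm (X \<omega> - Y \<omega>)} \<in> sets M"
    if XY: "X \<in> borel_measurable G" "Y \<in> borel_measurable G" for e and X Y :: "'a \<Rightarrow> 'b"
  proof -
    have [measurable]: "X \<in> borel_measurable M" "Y \<in> borel_measurable M"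
      using XY measurable_from_subalg[OF assms(2)] by auto
    show ?thesis by measurable
  qed
  have "\<exists>e>0. \<forall>Y\<in>borel_measurable G.
      measure M {\<omega>\<in>space M. e < norm (X \<omega> - Y \<omega>)} < e \<longrightarrow> Y \<in> borel_measurable G - A"
    if X: "X \<in> borel_measurable G - A" for X
  proof (rule ccontr)
    assume "\<not> ?thesis"
    hence "\<exists>Y\<in>A. measure M {\<omega>\<in>space M. e < norm (X \<omega> - Y \<omega>)} < e" if "e > 0" for e
      using that by blast
    hence "\<exists>Y\<in>A. measure M {\<omega>\<in>space M. inverse (real (Suc n)) < norm (X \<omega> - Y \<omega>)}
        < inverse (real (Suc n))" for n
      by simp
    then obtain Y where Y: "\<And>n. Y n \<in> A"
      and small: "\<And>n. measure M {\<omega>\<in>space M. inverse (real (Suc n)) < norm (X \<omega> - Y n \<omega>)}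
        < inverse (real (Suc n))"
      by metis
    have "(\<lambda>n. measure M {\<omega>\<in>space M. e < norm (X \<omega> - Y n \<omega>)}) \<longlonglongrightarrow> 0" if e: "e > 0" for e
    proof (rule tendsto_sandwich[OF _ _ tendsto_const LIMSEQ_inverse_real_of_nat])
      show "\<forall>\<^sub>F n in sequentially. 0 \<le> measure M {\<omega>\<in>space M. e < norm (X \<omega> - Y n \<omega>)}"
        by simp
      have "\<forall>\<^sub>F n in sequentially. inverse (real (Suc n)) < e"
        using order_tendstoD(2)[OF LIMSEQ_inverse_real_of_nat e] .
      thus "\<forall>\<^sub>F n in sequentially.
          measure M {\<omega>\<in>space M. e < norm (X \<omega> - Y n \<omega>)} \<le> inverse (real (Suc n))"
      proof eventually_elim
        case (elim n)
        have "measure M {\<omega>\<in>space M. e < norm (X \<omega> - Y n \<omega>)}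
            \<le> measure M {\<omega>\<in>space M. inverse (real (Suc n)) < norm (X \<omega> - Y n \<omega>)}"
        proof (rule finite_measure_mono)
          show "{\<omega>\<in>space M. inverse (real (Suc n)) < norm (X \<omega> - Y n \<omega>)} \<in> sets M"
            using X Y sub by (intro meas) auto
        qed (use elim in auto)
        thus ?case using small[of n] by simp
      qed
    qed
    hence "X \<in> A" using R Y X by blast
    thus False using X by simp
  qed
  hence "openin (L0_topology M G) (borel_measurable G - A)"
    unfolding openin_L0_topology[OF assms] by blast
  thus ?L using sub by (simp add: closedin_def topspace_L0_topology[OF assms])
qed

definition L0_in :: "'a measure \<Rightarrow> 'a measure \<Rightarrow> ('a \<Rightarrow> 'b::euclidean_space set) \<Rightarrow> ('a \<Rightarrow> 'b) set" where
  "L0_in M G S = {X \<in> borel_measurable G. AE \<omega> in M. X \<omega> \<in> S \<omega>}"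


subsection \<open>Bid-ask processes and trading cones\<close>

definition bid_ask_matrix :: "real^'n^'n \<Rightarrow> bool" where
  "bid_ask_matrix P \<longleftrightarrow>
     (\<forall>i j. P $ i $ j > 0) \<and> (\<forall>i. P $ i $ i = 1) \<and> (\<forall>i j k. P $ i $ j * P $ j $ k \<ge> P $ i $ k)"

definition bid_ask_process ::
  "'a measure \<Rightarrow> (nat \<Rightarrow> 'a measure) \<Rightarrow> nat \<Rightarrow> (nat \<Rightarrow> 'a \<Rightarrow> real^'n^'n) \<Rightarrow> bool" where
  "bid_ask_process M F T \<pi> \<longleftrightarrow>
     adapted F T \<pi> \<and> (\<forall>t\<le>T. \<forall>\<omega>\<in>space M. bid_ask_matrix (\<pi> t \<omega>))"

definition solvency_cone :: "real^'n^'n \<Rightarrow> (real^'n) set" where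
  "solvency_cone P = convex_cone hull
     (range (\<lambda>i. axis i 1) \<union> range (\<lambda>(i, j). (P $ i $ j) *\<^sub>R axis i 1 - axis j 1))"

definition polar_cone :: "'b::euclidean_space set \<Rightarrow> 'b set" where
  "polar_cone C = {y. \<forall>x\<in>C. y \<bullet> x \<le> 0}"

definition neg_cone :: "real^'n^'n \<Rightarrow> (real^'n) set" where
  "neg_cone P = uminus ` solvency_cone P"

definition trades ::
  "'a measure \<Rightarrow> (nat \<Rightarrow> 'a measure) \<Rightarrow> (nat \<Rightarrow> 'a \<Rightarrow> real^'n^'n) \<Rightarrow> nat \<Rightarrow> ('a \<Rightarrow> real^'n) set" where
  "trades M F \<pi> t = L0_in M (F t) (\<lambda>\<omega>. neg_cone (\<pi> t \<omega>))"

definition attainable ::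
  "'a measure \<Rightarrow> (nat \<Rightarrow> 'a measure) \<Rightarrow> nat \<Rightarrow> (nat \<Rightarrow> 'a \<Rightarrow> real^'n^'n) \<Rightarrow> ('a \<Rightarrow> real^'n) set" where
  "attainable M F T \<pi> = {X \<in> borel_measurable (F T).
     \<exists>\<xi>. (\<forall>t\<le>T. \<xi> t \<in> trades M F \<pi> t) \<and> (AE \<omega> in M. X \<omega> = (\<Sum>t\<le>T. \<xi> t \<omega>))}"

definition arbitrage_free :: "'a measure \<Rightarrow> 'a measure \<Rightarrow> ('a \<Rightarrow> real^'n) set \<Rightarrow> bool" where
  "arbitrage_free M G A \<longleftrightarrow>
     A \<inter> L0_in M G (\<lambda>\<omega>. {x. \<forall>i. 0 \<le> x $ i}) = L0_in M G (\<lambda>\<omega>. {0})"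

definition self_financing ::
  "'a measure \<Rightarrow> (nat \<Rightarrow> 'a measure) \<Rightarrow> nat \<Rightarrow> (nat \<Rightarrow> 'a \<Rightarrow> real^'n^'n) \<Rightarrow>
    (nat \<Rightarrow> 'a \<Rightarrow> real^'n) \<Rightarrow> bool" where
  "self_financing M F T \<pi> \<eta> \<longleftrightarrow> adapted F T \<eta> \<and>
     (\<forall>t\<le>T. (\<lambda>\<omega>. \<eta> t \<omega> - (if t = 0 then 0 else \<eta> (t - 1) \<omega>)) \<in> trades M F \<pi> t)"


subsection \<open>Consistent price processes\<close>

text \<open>Conditional expectations of vectors are taken componentwise.\<close>

definition vec_martingale ::
  "'a measure \<Rightarrow> (nat \<Rightarrow> 'a measure) \<Rightarrow> nat \<Rightarrow> (nat \<Rightarrow> 'a \<Rightarrow> real^'n) \<Rightarrow> bool" where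
  "vec_martingale M F T Z \<longleftrightarrow> adapted F T Z \<and> (\<forall>t\<le>T. integrable M (Z t)) \<and>
     (\<forall>s t. s \<le> t \<and> t \<le> T \<longrightarrow>
       (\<forall>i. AE \<omega> in M. real_cond_exp M (F s) (\<lambda>\<omega>'. Z t \<omega>' $ i) \<omega> = Z s \<omega> $ i))"

definition consistent_price_process ::
  "'a measure \<Rightarrow> (nat \<Rightarrow> 'a measure) \<Rightarrow> nat \<Rightarrow> (nat \<Rightarrow> 'a \<Rightarrow> real^'n^'n) \<Rightarrow>
    (nat \<Rightarrow> 'a \<Rightarrow> real^'n) \<Rightarrow> bool" where
  "consistent_price_process M F T \<pi> Z \<longleftrightarrow> vec_martingale M F T Z \<and>
     (\<forall>t\<le>T. AE \<omega> in M. Z t \<omega> \<in> polar_cone (neg_cone (\<pi> t \<omega>)) - {0})"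

text \<open>The expectation of a random variable with integrable negative part, possibly \<open>\<infinity>\<close>. The
  Bochner integral would give the value 0 whenever the positive part is not integrable.\<close>

definition ext_expectation :: "'a measure \<Rightarrow> ('a \<Rightarrow> real) \<Rightarrow> ereal" where
  "ext_expectation M X =
     enn2ereal (\<integral>\<^sup>+\<omega>. ennreal (X \<omega>) \<partial>M) - enn2ereal (\<integral>\<^sup>+\<omega>. ennreal (- X \<omega>) \<partial>M)"

end

theory Submission
  imports Defs
begin

text \<open>If \<open>\<theta>\<close> is the terminal value of a sum of trades, then stripping off the trades one date at a
  time bounds \<open>\<theta> \<bullet> Z\<^sub>T\<close> by a sum of nonpositive terms; truncation by \<open>norm \<le> n\<close> shows that the
  integrability of the negative part is inherited by earlier dates.

  Conversely, under an equivalent measure the claim \<open>\<theta>\<close> is square integrable, so if it is not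
  attainable the residual of its Hilbert space projection onto the closed cone of attainable claims
  is a density pricing \<open>\<theta>\<close> positively and all attainable claims nonpositively. Adding a small
  multiple of an almost surely nonzero such density, which exists by exhaustion as there is no
  arbitrage, and taking conditional expectations yields a consistent price process.\<close>

subsection \<open>Integration\<close>

text \<open>Two obstacles shape the proof. Valued at the terminal price, the individual trades may
  fail to be integrable, so the expectation of \<open>\<theta> \<bullet> Z T\<close> cannot be split
  into its summands; only running sums are under control, and only from one side. Conversely, claims
  need not have moments, and convergence in probability does not supply enough continuous linear
  functionals to separate with. Dividing by a positive weight cures this at no cost: it respects
  cones and almost sure convergence, hence closedness, and it bounds \<open>\<theta>\<close>. A
  separating density may vanish on a set of positive probability, whereas a price must be nonzero.
  The strict inequality at \<open>\<theta>\<close> leaves room for a perturbation. It is enough to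
  secure nonvanishing at the terminal date: positive exchange rates spread positivity from one
  component to all of them, and conditional expectation preserves strict positivity.\<close>

lemma borel_measurable_vec_nth [measurable (raw)]:
  fixes f :: "'a \<Rightarrow> 'b::euclidean_space^'n"
  assumes "f \<in> borel_measurable N"
  shows "(\<lambda>\<omega>. f \<omega> $ i) \<in> borel_measurable N"
proof -
  have "(\<lambda>x :: 'b^'n. x $ i) \<in> borel_measurable borel"
    by (intro borel_measurable_continuous_onI continuous_intros)
  from measurable_compose[OF assms this] show ?thesis .
qed

lemma vec_eq_sum_axis: "x = (\<Sum>i\<in>UNIV. x $ i *\<^sub>R axis i 1)" for x :: "real^'n"
  using basis_expansion[of x] by (simp add: scalar_mult_eq_scaleR)

lemma borel_measurable_vec_lambda:
  assumes "\<And>i. f i \<in> borel_measurable N"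
  shows "(\<lambda>\<omega>. (\<chi> i. f i \<omega>) :: real^'n) \<in> borel_measurable N"
proof -
  have "(\<lambda>\<omega>. (\<chi> i. f i \<omega>) :: real^'n) = (\<lambda>\<omega>. \<Sum>i\<in>UNIV. f i \<omega> *\<^sub>R axis i 1)"
    by (rule ext, subst vec_eq_sum_axis, simp)
  thus ?thesis using assms by simp
qed

lemma integrable_vec_lambda:
  assumes "\<And>i. integrable M (f i)"
  shows "integrable M (\<lambda>\<omega>. (\<chi> i. f i \<omega>) :: real^'n)"
proof -
  have "(\<lambda>\<omega>. (\<chi> i. f i \<omega>) :: real^'n) = (\<lambda>\<omega>. \<Sum>i\<in>UNIV. f i \<omega> *\<^sub>R axis i 1)"
    by (rule ext, subst vec_eq_sum_axis, simp)
  thus ?thesis using assms by simp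
qed

lemma integrable_vec_nth:
  fixes f :: "'a \<Rightarrow> real^'n"
  assumes "integrable M f"
  shows "integrable M (\<lambda>\<omega>. f \<omega> $ i)"
proof -
  have "integrable M (\<lambda>\<omega>. f \<omega> \<bullet> axis i 1)" using assms by simp
  thus ?thesis by (simp add: inner_axis)
qed

lemma ext_expectation_integrable:
  assumes "integrable M X"
  shows "ext_expectation M X = ereal (\<integral>\<omega>. X \<omega> \<partial>M)"
proof -
  have fin: "(\<integral>\<^sup>+\<omega>. ennreal (X \<omega>) \<partial>M) < top" "(\<integral>\<^sup>+\<omega>. ennreal (- X \<omega>) \<partial>M) < top"
    using assms by (auto simp: real_integrable_def less_top)
  then obtain a b where ab: "a \<ge> 0" "(\<integral>\<^sup>+\<omega>. ennreal (X \<omega>) \<partial>M) = ennreal a"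
    "b \<ge> 0" "(\<integral>\<^sup>+\<omega>. ennreal (- X \<omega>) \<partial>M) = ennreal b"
    by (metis less_top_ennreal)
  have "(\<integral>\<omega>. X \<omega> \<partial>M) = a - b"
    unfolding real_lebesgue_integral_def[OF assms] ab using ab by simp
  thus ?thesis unfolding ext_expectation_def ab using ab by (simp add: enn2ereal_ennreal)
qed

text \<open>The bounds may vary with \<open>n\<close>, because the values along a minimizing
  sequence only approach the infimum; the truncation arguments use a constant sequence.
  Integrability of the limit is a conclusion, drawn from the bounds.\<close>

lemma integral_Fatou:
  fixes f :: "nat \<Rightarrow> 'a \<Rightarrow> real"
  assumes f: "\<And>n. integrable M (f n)" "\<And>n. AE \<omega> in M. 0 \<le> f n \<omega>"
    and g [measurable]: "g \<in> borel_measurable M"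
    and lim: "AE \<omega> in M. (\<lambda>n. f n \<omega>) \<longlonglongrightarrow> g \<omega>"
    and c: "\<And>n. (\<integral>\<omega>. f n \<omega> \<partial>M) \<le> c n" "c \<longlonglongrightarrow> d"
  shows "integrable M g" "(\<integral>\<omega>. g \<omega> \<partial>M) \<le> d"
proof -
  have [measurable]: "f n \<in> borel_measurable M" for n using f(1) by simp
  have f0: "AE \<omega> in M. \<forall>n. 0 \<le> f n \<omega>" using f(2) by (simp add: AE_all_countable)
  have g0: "AE \<omega> in M. 0 \<le> g \<omega>"
    using lim f0 by eventually_elim (meson LIMSEQ_le_const)
  have c0: "0 \<le> c n" for n
    using integral_nonneg_AE[OF f(2)[of n]] c(1)[of n] by simp
  have d0: "0 \<le> d" using c0 c(2) by (meson LIMSEQ_le_const)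
  have "(\<integral>\<^sup>+\<omega>. ennreal (g \<omega>) \<partial>M) = (\<integral>\<^sup>+\<omega>. liminf (\<lambda>n. ennreal (f n \<omega>)) \<partial>M)"
  proof (rule nn_integral_cong_AE)
    show "AE \<omega> in M. ennreal (g \<omega>) = liminf (\<lambda>n. ennreal (f n \<omega>))"
      using lim
    proof eventually_elim
      case (elim \<omega>)
      hence "(\<lambda>n. ennreal (f n \<omega>)) \<longlonglongrightarrow> ennreal (g \<omega>)" by (rule tendsto_ennrealI)
      from lim_imp_Liminf[OF trivial_limit_sequentially this] show ?case by (rule sym)
    qed
  qed
  also have "\<dots> \<le> liminf (\<lambda>n. \<integral>\<^sup>+\<omega>. ennreal (f n \<omega>) \<partial>M)"
    by (rule nn_integral_liminf) measurable
  also have "\<dots> \<le> liminf (\<lambda>n. ennreal (c n))"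
    unfolding nn_integral_eq_integral[OF f]
    by (intro Liminf_mono always_eventually allI ennreal_leI c)
  also have "\<dots> = ennreal d"
    by (rule lim_imp_Liminf[OF trivial_limit_sequentially tendsto_ennrealI[OF c(2)]])
  finally have le: "(\<integral>\<^sup>+\<omega>. ennreal (g \<omega>) \<partial>M) \<le> ennreal d" .
  show int: "integrable M g"
  proof (rule integrableI_bounded)
    have "(\<integral>\<^sup>+\<omega>. ennreal (norm (g \<omega>)) \<partial>M) = (\<integral>\<^sup>+\<omega>. ennreal (g \<omega>) \<partial>M)"
      by (rule nn_integral_cong_AE) (use g0 in eventually_elim, simp)
    thus "(\<integral>\<^sup>+\<omega>. ennreal (norm (g \<omega>)) \<partial>M) < \<infinity>" using le by (simp add: le_less_trans)
  qed simp
  from le d0 show "(\<integral>\<omega>. g \<omega> \<partial>M) \<le> d"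
    unfolding nn_integral_eq_integral[OF int g0] by simp
qed

lemma (in prob_space) AE_tendsto_imp_prob_tendsto:
  fixes X :: "'a \<Rightarrow> 'b::euclidean_space"
  assumes [measurable]: "X \<in> borel_measurable M" "\<And>n. Y n \<in> borel_measurable M"
    and lim: "AE \<omega> in M. (\<lambda>n. Y n \<omega>) \<longlonglongrightarrow> X \<omega>" and "0 < e"
  shows "(\<lambda>n. measure M {\<omega>\<in>space M. e < norm (X \<omega> - Y n \<omega>)}) \<longlonglongrightarrow> 0"
proof -
  define I :: "nat \<Rightarrow> 'a \<Rightarrow> real" where "I n = indicator {\<omega>\<in>space M. e < norm (X \<omega> - Y n \<omega>)}" for n
  have "(\<lambda>n. integral\<^sup>L M (I n)) \<longlonglongrightarrow> (\<integral>\<omega>. 0 \<partial>M)"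
  proof (rule integral_dominated_convergence[where w="\<lambda>_. 1"])
    show "AE \<omega> in M. (\<lambda>n. I n \<omega>) \<longlonglongrightarrow> 0"
      using lim
    proof eventually_elim
      case (elim \<omega>)
      hence "(\<lambda>n. norm (X \<omega> - Y n \<omega>)) \<longlonglongrightarrow> 0"
        using tendsto_norm[OF tendsto_diff[OF tendsto_const elim], of "X \<omega>"] by simp
      hence "\<forall>\<^sub>F n in sequentially. norm (X \<omega> - Y n \<omega>) < e"
        using \<open>0 < e\<close> by (rule order_tendstoD)
      hence "\<forall>\<^sub>F n in sequentially. I n \<omega> = 0"
        by eventually_elim (auto simp: I_def)
      thus ?case by (rule tendsto_eventually)
    qed
  qed (auto simp: I_def indicator_def)
  thus ?thesis by (simp add: I_def)
qed

text \<open>Almost sure convergence implies convergence in probability. For a constant sequence this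
  gives invariance under almost sure equality.\<close>

lemma closedin_L0_AE_limit:
  assumes M: "prob_space M" "subalgebra M G" and A: "closedin (L0_topology M G) A"
    and Y: "\<And>n::nat. Y n \<in> A" and X: "X \<in> borel_measurable G"
    and lim: "AE \<omega> in M. (\<lambda>n. Y n \<omega>) \<longlonglongrightarrow> X \<omega>"
  shows "X \<in> A"
proof -
  interpret prob_space M by fact
  have sub: "A \<subseteq> borel_measurable G"
    using A unfolding closedin_L0_topology_iff[OF M] by simp
  have "(\<lambda>n. measure M {\<omega>\<in>space M. e < norm (X \<omega> - Y n \<omega>)}) \<longlonglongrightarrow> 0" if "e > 0" for e
    using X Y sub M(2) lim that
    by (intro AE_tendsto_imp_prob_tendsto) (auto intro: measurable_from_subalg)
  thus ?thesis
    using A X Y unfolding closedin_L0_topology_iff[OF M] by blast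
qed

section \<open>Square integrable functions\<close>

lemma integrable_inner_L2:
  fixes f g :: "'a \<Rightarrow> 'b::euclidean_space"
  assumes [measurable]: "f \<in> borel_measurable M" "g \<in> borel_measurable M"
    and "integrable M (\<lambda>\<omega>. norm (f \<omega>) ^ 2)" "integrable M (\<lambda>\<omega>. norm (g \<omega>) ^ 2)"
  shows "integrable M (\<lambda>\<omega>. f \<omega> \<bullet> g \<omega>)"
proof (rule Bochner_Integration.integrable_bound)
  show "integrable M (\<lambda>\<omega>. norm (f \<omega>) ^ 2 + norm (g \<omega>) ^ 2)" using assms by simp
  have "\<bar>x \<bullet> y\<bar> \<le> norm x ^ 2 + norm y ^ 2" for x y :: 'b
  proof -
    have "\<bar>x \<bullet> y\<bar> \<le> norm x * norm y" by (rule Cauchy_Schwarz_ineq2)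
    also have "\<dots> \<le> norm x ^ 2 + norm y ^ 2"
      using sum_squares_bound[of "norm x" "norm y"] mult_nonneg_nonneg[OF norm_ge_zero norm_ge_zero, of x y]
      by linarith
    finally show ?thesis .
  qed
  thus "AE \<omega> in M. norm (f \<omega> \<bullet> g \<omega>) \<le> norm (norm (f \<omega>) ^ 2 + norm (g \<omega>) ^ 2)" by simp
qed simp

lemma norm_add_power2: "norm (x + y) ^ 2 = norm x ^ 2 + 2 * (x \<bullet> y) + norm y ^ 2"
  for x y :: "'b::real_inner"
  by (simp add: power2_norm_eq_inner inner_simps inner_commute)

lemma integrable_add_L2:
  fixes f g :: "'a \<Rightarrow> 'b::euclidean_space"
  assumes [measurable]: "f \<in> borel_measurable M" "g \<in> borel_measurable M"
    and "integrable M (\<lambda>\<omega>. norm (f \<omega>) ^ 2)" "integrable M (\<lambda>\<omega>. norm (g \<omega>) ^ 2)"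
  shows "integrable M (\<lambda>\<omega>. norm (f \<omega> + g \<omega>) ^ 2)"
  unfolding norm_add_power2 using assms integrable_inner_L2[OF assms] by simp

text \<open>First-order condition at a minimum: divide by \<open>t\<close> and let \<open>t\<close>
  decrease to 0. Only \<open>t < 1\<close> is demanded, since a vector can be shrunk no further than
  to the apex of a cone.\<close>

lemma quadratic_nonneg_imp_linear_nonneg:
  assumes "\<And>t::real. 0 < t \<Longrightarrow> t < 1 \<Longrightarrow> 0 \<le> t * a + t\<^sup>2 * b"
  shows "0 \<le> a"
proof -
  have "0 \<le> a + t * b" if "t \<in> {0<..<1}" for t
  proof -
    have "0 \<le> t * (a + t * b)" using assms[of t] that by (simp add: algebra_simps power2_eq_square)
    thus ?thesis using that by (simp add: zero_le_mult_iff)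
  qed
  hence "\<forall>\<^sub>F t in at_right 0. 0 \<le> a + t * b"
    by (auto simp: eventually_at_right_field intro!: exI[of _ 1])
  moreover have "((\<lambda>t. a + t * b) \<longlongrightarrow> a + 0 * b) (at_right 0)"
    by (intro tendsto_intros)
  ultimately show ?thesis
    using tendsto_lowerbound[of "\<lambda>t. a + t * b" "a + 0 * b" "at_right 0" 0] by simp
qed

subsection \<open>Separation from cones closed in probability\<close>

text \<open>Integrating \<open>2 * a \<le> a ^ 2 / e + e\<close>, that is
  \<open>0 \<le> (a - e) ^ 2 / e\<close>, takes the place of the Cauchy-Schwarz inequality for
  integrals; \<open>e\<close> is tuned to the size of the second moment.\<close>

lemma (in finite_measure) L1_norm_le_of_L2:
  fixes f :: "'a \<Rightarrow> 'b::euclidean_space"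
  assumes [measurable]: "f \<in> borel_measurable M" and "integrable M (\<lambda>\<omega>. norm (f \<omega>) ^ 2)"
  shows "integrable M f"
    and "0 < e \<Longrightarrow> 2 * (\<integral>\<omega>. norm (f \<omega>) \<partial>M) \<le> (\<integral>\<omega>. norm (f \<omega>) ^ 2 \<partial>M) / e + e * measure M (space M)"
proof -
  have am_gm: "2 * a \<le> a ^ 2 / e + e" if "e > 0" for a e :: real
  proof -
    have "0 \<le> (a - e) ^ 2 / e" using that by simp
    also have "\<dots> = a ^ 2 / e + e - 2 * a" using that by (simp add: field_simps power2_eq_square)
    finally show ?thesis by simp
  qed
  show int: "integrable M f"
  proof (rule Bochner_Integration.integrable_bound)
    show "integrable M (\<lambda>\<omega>. norm (f \<omega>) ^ 2 + 1)" using assms by simp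
    have "norm (f \<omega>) \<le> norm (norm (f \<omega>) ^ 2 + 1)" for \<omega>
      using am_gm[of 1 "norm (f \<omega>)"] norm_ge_zero[of "f \<omega>"] by (simp del: norm_ge_zero)
    thus "AE \<omega> in M. norm (f \<omega>) \<le> norm (norm (f \<omega>) ^ 2 + 1)" by simp
  qed simp
  assume e: "0 < e"
  have "(\<integral>\<omega>. 2 * norm (f \<omega>) \<partial>M) \<le> (\<integral>\<omega>. norm (f \<omega>) ^ 2 / e + e \<partial>M)"
    by (rule integral_mono) (use int assms am_gm[OF e] in auto)
  also have "\<dots> = (\<integral>\<omega>. norm (f \<omega>) ^ 2 \<partial>M) / e + e * measure M (space M)"
    using assms by simp
  finally show "2 * (\<integral>\<omega>. norm (f \<omega>) \<partial>M) \<le> (\<integral>\<omega>. norm (f \<omega>) ^ 2 \<partial>M) / e + e * measure M (space M)"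
    by simp
qed

text \<open>The separating \<open>y\<close> is the residual of the Hilbert space projection of \<open>f\<close> onto the square
  integrable part of \<open>C\<close>, obtained from an almost surely convergent minimizing sequence. This
  replaces the Hahn--Banach theorem for \<open>L\<^sup>1\<close> and \<open>L\<^sup>\<infinity>\<close>.\<close>

lemma (in prob_space) L2_cone_separation:
  fixes C :: "('a \<Rightarrow> 'b::euclidean_space) set"
  assumes G: "subalgebra M G" and C: "C \<subseteq> borel_measurable G" and zero: "(\<lambda>_. 0) \<in> C"
    and add: "\<And>u v. u \<in> C \<Longrightarrow> v \<in> C \<Longrightarrow> (\<lambda>\<omega>. u \<omega> + v \<omega>) \<in> C"
    and scale: "\<And>u c. u \<in> C \<Longrightarrow> 0 \<le> c \<Longrightarrow> (\<lambda>\<omega>. c *\<^sub>R u \<omega>) \<in> C"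
    and closed: "\<And>u v. (\<And>n::nat. u n \<in> C) \<Longrightarrow> v \<in> borel_measurable G \<Longrightarrow>
      AE \<omega> in M. (\<lambda>n. u n \<omega>) \<longlonglongrightarrow> v \<omega> \<Longrightarrow> v \<in> C"
    and f: "f \<in> borel_measurable G" "integrable M (\<lambda>\<omega>. norm (f \<omega>) ^ 2)" "f \<notin> C"
  obtains y where "y \<in> borel_measurable G" "integrable M (\<lambda>\<omega>. norm (y \<omega>) ^ 2)"
    "0 < (\<integral>\<omega>. f \<omega> \<bullet> y \<omega> \<partial>M)"
    "\<And>v. v \<in> C \<Longrightarrow> integrable M (\<lambda>\<omega>. norm (v \<omega>) ^ 2) \<Longrightarrow> (\<integral>\<omega>. v \<omega> \<bullet> y \<omega> \<partial>M) \<le> 0"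
proof -
  define L where "L = {u \<in> borel_measurable M. integrable M (\<lambda>\<omega>. norm (u \<omega> :: 'b) ^ 2)}"
  have LM: "u \<in> L \<Longrightarrow> u \<in> borel_measurable M" for u by (simp add: L_def)
  have L_add: "(\<lambda>\<omega>. u \<omega> + v \<omega>) \<in> L" if "u \<in> L" "v \<in> L" for u v
    using that by (auto simp: L_def intro: integrable_add_L2)
  have L_scale: "(\<lambda>\<omega>. c *\<^sub>R u \<omega>) \<in> L" if "u \<in> L" for c u
    using that by (auto simp: L_def power_mult_distrib)
  have L_diff: "(\<lambda>\<omega>. u \<omega> - v \<omega>) \<in> L" if "u \<in> L" "v \<in> L" for u v
    using L_add[OF that(1) L_scale[OF that(2), of "-1"]] by simp
  have L_inner: "integrable M (\<lambda>\<omega>. u \<omega> \<bullet> v \<omega>)" if "u \<in> L" "v \<in> L" for u v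
    using that by (auto simp: L_def intro: integrable_inner_L2)
  have L_norm: "integrable M (\<lambda>\<omega>. norm (u \<omega>) ^ 2)" if "u \<in> L" for u
    using that by (simp add: L_def)
  have GM: "u \<in> borel_measurable M" if "u \<in> borel_measurable G" for u :: "'a \<Rightarrow> 'b"
    using that measurable_from_subalg[OF G] by blast
  have fL: "f \<in> L" using GM[OF f(1)] f(2) by (simp add: L_def)
  define Q where "Q u = (\<integral>\<omega>. norm (f \<omega> - u \<omega>) ^ 2 \<partial>M)" for u
  define S where "S = C \<inter> L"
  define d where "d = (INF u\<in>S. Q u)"
  have Q0: "0 \<le> Q u" for u by (simp add: Q_def)
  have "(\<lambda>_. 0) \<in> S" using zero by (simp add: S_def L_def)
  hence ne: "S \<noteq> {}" by auto
  have d_le: "d \<le> Q u" if "u \<in> S" for u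
    unfolding d_def by (rule cINF_lower[OF bdd_belowI2[OF Q0] that])
  have "\<exists>u\<in>S. Q u < d + inverse (real (Suc n))" for n
    using cINF_less_iff[OF ne bdd_belowI2[of S 0 Q, OF Q0], of "d + inverse (real (Suc n))"]
    by (simp add: d_def)
  then obtain u where u: "\<And>n. u n \<in> S" "\<And>n. Q (u n) < d + inverse (real (Suc n))" by metis
  have uL: "u n \<in> L" and uC: "u n \<in> C" for n using u(1)[of n] by (auto simp: S_def)
  \<comment> \<open>Parallelogram identity: the midpoint \<open>m\<close> lies in the cone, so
    \<open>Q m\<close> is at least the infimum \<open>d\<close>, which forces near-minimizers close
    together.\<close>
  have par: "(\<integral>\<omega>. norm (u i \<omega> - u j \<omega>) ^ 2 \<partial>M) \<le> 2 * inverse (real (Suc i)) + 2 * inverse (real (Suc j))"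
    for i j
  proof -
    define m where "m = (\<lambda>\<omega>. (1/2) *\<^sub>R (u i \<omega> + u j \<omega>))"
    have mS: "m \<in> S"
      unfolding S_def m_def using scale[OF add[OF uC uC], of "1/2"] L_scale[OF L_add[OF uL uL]] by simp
    hence mL: "m \<in> L" by (simp add: S_def)
    have eq: "norm (u i \<omega> - u j \<omega>) ^ 2
       = 2 * norm (f \<omega> - u i \<omega>) ^ 2 + 2 * norm (f \<omega> - u j \<omega>) ^ 2 - 4 * norm (f \<omega> - m \<omega>) ^ 2" for \<omega>
      unfolding m_def power2_norm_eq_inner by (simp add: inner_simps inner_commute field_simps)
    have "(\<integral>\<omega>. norm (u i \<omega> - u j \<omega>) ^ 2 \<partial>M) = 2 * Q (u i) + 2 * Q (u j) - 4 * Q m"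
      unfolding eq Q_def
      using L_norm[OF L_diff[OF fL uL]] L_norm[OF L_diff[OF fL mL]] by simp
    also have "\<dots> \<le> 2 * inverse (real (Suc i)) + 2 * inverse (real (Suc j))"
      using u(2)[of i] u(2)[of j] d_le[OF mS] by linarith
    finally show ?thesis .
  qed
  have Cauchy: "\<exists>N. \<forall>i\<ge>N. \<forall>j\<ge>N. (\<integral>\<omega>. norm (u i \<omega> - u j \<omega>) \<partial>M) < e" if e: "e > 0" for e
  proof -
    \<comment> \<open>With this margin the second moment of the difference is below
      \<open>e * e / 2\<close>, and twice its first moment is then below
      \<open>e / 2 + e\<close>.\<close>
    obtain N where N: "inverse (real (Suc N)) < e * e / 8"
      using reals_Archimedean[of "e * e / 8"] e by auto
    have "(\<integral>\<omega>. norm (u i \<omega> - u j \<omega>) \<partial>M) < e" if ij: "i \<ge> N" "j \<ge> N" for i j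
    proof -
      have inv: "inverse (real (Suc k)) \<le> inverse (real (Suc N))" if "k \<ge> N" for k
        using that by (intro le_imp_inverse_le) auto
      have "(\<integral>\<omega>. norm (u i \<omega> - u j \<omega>) ^ 2 \<partial>M) < e * e / 2"
        using par[of i j] inv[OF ij(1)] inv[OF ij(2)] N by linarith
      hence "(\<integral>\<omega>. norm (u i \<omega> - u j \<omega>) ^ 2 \<partial>M) / e < e / 2"
        using e by (simp add: field_simps)
      thus ?thesis
        using L1_norm_le_of_L2(2)[OF LM[OF L_diff[OF uL[of i] uL[of j]]] L_norm[OF L_diff[OF uL uL]] e,
          unfolded prob_space mult_1_right] e by linarith
    qed
    thus ?thesis by blast
  qed
  have "integrable M (u n)" for n
    using L1_norm_le_of_L2(1)[OF LM[OF uL] L_norm[OF uL]] .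
  \<comment> \<open>The cone is closed under almost sure limits, so the Cauchy property in mean is
    traded for an almost surely Cauchy subsequence.\<close>
  from cauchy_L1_AE_cauchy_subseq[OF this Cauchy]
  obtain r where r: "strict_mono r" "AE \<omega> in M. Cauchy (\<lambda>i. u (r i) \<omega>)" by blast
  \<comment> \<open>Taken at every point, with a fixed default value where the subsequence diverges,
    so that \<open>p\<close> is measurable for \<open>G\<close> itself.\<close>
  define p where "p = (\<lambda>\<omega>. lim (\<lambda>i. u (r i) \<omega>))"
  have pG: "p \<in> borel_measurable G"
    unfolding p_def by (rule borel_measurable_lim_metric) (use uC C in blast)
  have lim: "AE \<omega> in M. (\<lambda>i. u (r i) \<omega>) \<longlonglongrightarrow> p \<omega>"
    using r(2) unfolding p_def
    by eventually_elim (simp add: Cauchy_convergent_iff convergent_LIMSEQ_iff)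
  have pC: "p \<in> C" by (rule closed[OF uC pG lim])
  define y where "y = (\<lambda>\<omega>. f \<omega> - p \<omega>)"
  have yG: "y \<in> borel_measurable G" unfolding y_def using f pG by simp
  have ui: "integrable M (\<lambda>\<omega>. norm (f \<omega> - u (r n) \<omega>) ^ 2)" for n
    by (rule L_norm[OF L_diff[OF fL uL]])
  have ym: "(\<lambda>\<omega>. norm (y \<omega>) ^ 2) \<in> borel_measurable M" using GM[OF yG] by simp
  have ulim: "AE \<omega> in M. (\<lambda>n. norm (f \<omega> - u (r n) \<omega>) ^ 2) \<longlonglongrightarrow> norm (y \<omega>) ^ 2"
    using lim by eventually_elim (auto simp: y_def intro!: tendsto_intros)
  have uQ: "(\<integral>\<omega>. norm (f \<omega> - u (r n) \<omega>) ^ 2 \<partial>M) \<le> d + inverse (real (Suc (r n)))" for n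
    using u(2)[of "r n"] by (simp add: Q_def)
  have "(\<lambda>n. d + inverse (real (Suc n))) \<longlonglongrightarrow> d + 0"
    by (intro tendsto_intros LIMSEQ_inverse_real_of_nat)
  hence dlim: "(\<lambda>n. d + inverse (real (Suc (r n)))) \<longlonglongrightarrow> d"
    using LIMSEQ_subseq_LIMSEQ[OF _ r(1)] by (fastforce simp: o_def)
  \<comment> \<open>Lower semicontinuity suffices: \<open>p\<close> is square integrable with
    squared distance at most \<open>d\<close> from \<open>f\<close>, so it is a minimizer.\<close>
  note Fatou = integral_Fatou[OF ui AE_I2 ym ulim uQ dlim, OF zero_le_power2]
  have yL: "y \<in> L" using Fatou(1) GM[OF yG] by (simp add: L_def)
  have pL: "p \<in> L" using L_diff[OF fL yL] by (simp add: y_def)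
  have pS: "p \<in> S" using pC pL by (simp add: S_def)
  \<comment> \<open>Variational inequality for every direction that keeps \<open>p\<close> in
    \<open>S\<close>; it serves both for elements of the cone and for \<open>- p\<close>.\<close>
  have var: "(\<integral>\<omega>. v \<omega> \<bullet> y \<omega> \<partial>M) \<le> 0"
    if v: "v \<in> L" and S: "\<And>t. 0 < t \<Longrightarrow> t < 1 \<Longrightarrow> (\<lambda>\<omega>. p \<omega> + t *\<^sub>R v \<omega>) \<in> S" for v
  proof -
    have "0 \<le> t * (- (2 * (\<integral>\<omega>. v \<omega> \<bullet> y \<omega> \<partial>M))) + t\<^sup>2 * (\<integral>\<omega>. norm (v \<omega>) ^ 2 \<partial>M)"
      if t: "0 < t" "t < 1" for t
    proof -
      have eq: "norm (f \<omega> - (p \<omega> + t *\<^sub>R v \<omega>)) ^ 2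
          = norm (y \<omega>) ^ 2 + (- 2 * t) * (v \<omega> \<bullet> y \<omega>) + t\<^sup>2 * norm (v \<omega>) ^ 2" for \<omega>
        unfolding y_def power2_norm_eq_inner
        by (simp add: inner_simps inner_commute algebra_simps power2_eq_square)
      have "(\<integral>\<omega>. norm (y \<omega>) ^ 2 \<partial>M) \<le> Q (\<lambda>\<omega>. p \<omega> + t *\<^sub>R v \<omega>)"
        using Fatou(2) d_le[OF S[OF t]] by simp
      also have "\<dots> = (\<integral>\<omega>. norm (y \<omega>) ^ 2 \<partial>M) + (- 2 * t) * (\<integral>\<omega>. v \<omega> \<bullet> y \<omega> \<partial>M)
          + t\<^sup>2 * (\<integral>\<omega>. norm (v \<omega>) ^ 2 \<partial>M)"
        unfolding Q_def eq using L_norm[OF yL] L_norm[OF v] L_inner[OF v yL] by simp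
      finally show ?thesis by simp
    qed
    from quadratic_nonneg_imp_linear_nonneg[OF this] show ?thesis by simp
  qed
  show thesis
  proof (rule that[OF yG Fatou(1)])
    show "(\<integral>\<omega>. v \<omega> \<bullet> y \<omega> \<partial>M) \<le> 0" if "v \<in> C" "integrable M (\<lambda>\<omega>. norm (v \<omega>) ^ 2)" for v
    proof (rule var)
      show vL: "v \<in> L" using that(2) GM[of v] subsetD[OF C that(1)] by (simp add: L_def)
      show "(\<lambda>\<omega>. p \<omega> + t *\<^sub>R v \<omega>) \<in> S" if "0 < t" for t
        using add[OF pC scale[OF \<open>v \<in> C\<close>, of t]] L_add[OF pL L_scale[OF vL, of t]] that
        by (simp add: S_def)
    qed
    \<comment> \<open>The direction \<open>- p\<close> is admissible because
      \<open>(1 - t) *\<^sub>R p \<omega>\<close> stays in the cone.\<close>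
    have "(\<integral>\<omega>. (- p \<omega>) \<bullet> y \<omega> \<partial>M) \<le> 0"
    proof (rule var)
      show "(\<lambda>\<omega>. - p \<omega>) \<in> L" using L_scale[OF pL, of "-1"] by simp
      show "(\<lambda>\<omega>. p \<omega> + t *\<^sub>R (- p \<omega>)) \<in> S" if "0 < t" "t < 1" for t
        using scale[OF pC, of "1 - t"] L_scale[OF pL, of "1 - t"] that
        by (simp add: S_def algebra_simps)
    qed
    hence p: "0 \<le> (\<integral>\<omega>. p \<omega> \<bullet> y \<omega> \<partial>M)" by simp
    \<comment> \<open>A zero residual would make \<open>f\<close> the almost sure limit of the
      constant sequence \<open>p\<close>, hence a member of \<open>C\<close>.\<close>
    have "(\<integral>\<omega>. norm (y \<omega>) ^ 2 \<partial>M) \<noteq> 0"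
    proof
      assume "(\<integral>\<omega>. norm (y \<omega>) ^ 2 \<partial>M) = 0"
      hence "AE \<omega> in M. norm (y \<omega>) ^ 2 = 0"
        using integral_nonneg_eq_0_iff_AE[OF Fatou(1)] by simp
      hence "AE \<omega> in M. p \<omega> = f \<omega>" by eventually_elim (simp add: y_def)
      hence "AE \<omega> in M. (\<lambda>n. p \<omega>) \<longlonglongrightarrow> f \<omega>" by eventually_elim simp
      from closed[OF pC f(1) this] f(3) show False by blast
    qed
    hence "0 < (\<integral>\<omega>. norm (y \<omega>) ^ 2 \<partial>M)" by (simp add: less_le)
    moreover have "(\<integral>\<omega>. f \<omega> \<bullet> y \<omega> \<partial>M) = (\<integral>\<omega>. norm (y \<omega>) ^ 2 + p \<omega> \<bullet> y \<omega> \<partial>M)"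
      by (rule Bochner_Integration.integral_cong)
        (simp_all add: y_def power2_norm_eq_inner inner_simps inner_commute)
    moreover have "\<dots> = (\<integral>\<omega>. norm (y \<omega>) ^ 2 \<partial>M) + (\<integral>\<omega>. p \<omega> \<bullet> y \<omega> \<partial>M)"
      using L_norm[OF yL] L_inner[OF pL yL] by simp
    ultimately show "0 < (\<integral>\<omega>. f \<omega> \<bullet> y \<omega> \<partial>M)" using p by simp
  qed
qed

text \<open>Measuring \<open>X\<close> by the square of \<open>X / w\<close> amounts to passing to an equivalent measure
  under which the claim \<open>f\<close> is square integrable.\<close>

lemma L0_cone_separation:
  fixes A :: "('a \<Rightarrow> 'b::euclidean_space) set"
  assumes M: "prob_space M" "subalgebra M G" and A: "closedin (L0_topology M G) A"
    and zero: "(\<lambda>_. 0) \<in> A"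
    and add: "\<And>X Y. X \<in> A \<Longrightarrow> Y \<in> A \<Longrightarrow> (\<lambda>\<omega>. X \<omega> + Y \<omega>) \<in> A"
    and scale: "\<And>X c. X \<in> A \<Longrightarrow> 0 \<le> c \<Longrightarrow> (\<lambda>\<omega>. c *\<^sub>R X \<omega>) \<in> A"
    and w: "w \<in> borel_measurable G" "\<And>\<omega>. 1 \<le> w \<omega>"
    and f: "f \<in> borel_measurable G" "\<And>\<omega>. norm (f \<omega>) \<le> b * w \<omega>" "f \<notin> A"
  obtains Z where "Z \<in> borel_measurable G" "integrable M (\<lambda>\<omega>. w \<omega> * norm (Z \<omega>))"
    "0 < (\<integral>\<omega>. f \<omega> \<bullet> Z \<omega> \<partial>M)"
    "\<And>X b. X \<in> A \<Longrightarrow> (\<And>\<omega>. norm (X \<omega>) \<le> b * w \<omega>) \<Longrightarrow> (\<integral>\<omega>. X \<omega> \<bullet> Z \<omega> \<partial>M) \<le> 0"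
proof -
  interpret prob_space M by fact
  have AG: "A \<subseteq> borel_measurable G"
    using A unfolding closedin_L0_topology_iff[OF M] by simp
  have w0: "0 < w \<omega>" for \<omega> using w(2)[of \<omega>] by simp
  have wM [measurable]: "w \<in> borel_measurable M"
    using w(1) by (rule measurable_from_subalg[OF M(2)])
  define sc where "sc X = (\<lambda>\<omega>. (1 / w \<omega>) *\<^sub>R X \<omega>)" for X :: "'a \<Rightarrow> 'b"
  have sc_G: "sc X \<in> borel_measurable G" if "X \<in> borel_measurable G" for X
    unfolding sc_def using that w(1) by simp
  have sc_L2: "integrable M (\<lambda>\<omega>. norm (sc X \<omega>) ^ 2)"
    if "X \<in> borel_measurable G" "\<And>\<omega>. norm (X \<omega>) \<le> b * w \<omega>" for X b
  proof (rule integrable_const_bound[where B="b\<^sup>2"])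
    show "(\<lambda>\<omega>. norm (sc X \<omega>) ^ 2) \<in> borel_measurable M"
      using measurable_from_subalg[OF M(2) sc_G[OF that(1)]] by simp
    have "norm (sc X \<omega>) \<le> b" for \<omega>
      using that(2)[of \<omega>] w0[of \<omega>] by (simp add: sc_def field_simps)
    thus "AE \<omega> in M. norm (norm (sc X \<omega>) ^ 2) \<le> b\<^sup>2"
      by (simp add: power_mono)
  qed
  \<comment> \<open>The cone \<open>A\<close> seen after division by \<open>w\<close>.
    Multiplication by the fixed function \<open>w\<close> preserves almost sure limits, so
    \<open>C\<close> inherits closedness.\<close>
  define C where "C = {u \<in> borel_measurable G. (\<lambda>\<omega>. w \<omega> *\<^sub>R u \<omega>) \<in> A}"
  have sc_C: "sc X \<in> C \<longleftrightarrow> X \<in> A" if "X \<in> borel_measurable G" for X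
    using sc_G[OF that] w0 by (simp add: C_def sc_def less_imp_neq[symmetric])
  show thesis
  proof (rule L2_cone_separation[OF M(2), of C "sc f"])
    show "C \<subseteq> borel_measurable G" by (auto simp: C_def)
    show "(\<lambda>_. 0) \<in> C" using zero by (simp add: C_def)
    show "(\<lambda>\<omega>. u \<omega> + v \<omega>) \<in> C" if "u \<in> C" "v \<in> C" for u v
      using that add[of "\<lambda>\<omega>. w \<omega> *\<^sub>R u \<omega>" "\<lambda>\<omega>. w \<omega> *\<^sub>R v \<omega>"] by (auto simp: C_def algebra_simps)
    show "(\<lambda>\<omega>. c *\<^sub>R u \<omega>) \<in> C" if "u \<in> C" "0 \<le> c" for u c
      using that scale[of "\<lambda>\<omega>. w \<omega> *\<^sub>R u \<omega>" c] by (auto simp: C_def mult.commute intro!: borel_measurable_scaleR)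
    show "v \<in> C" if u: "\<And>n::nat. u n \<in> C" and v: "v \<in> borel_measurable G"
      and lim: "AE \<omega> in M. (\<lambda>n. u n \<omega>) \<longlonglongrightarrow> v \<omega>" for u v
    proof -
      have "(\<lambda>\<omega>. w \<omega> *\<^sub>R v \<omega>) \<in> A"
      proof (rule closedin_L0_AE_limit[OF M A])
        show "(\<lambda>\<omega>. w \<omega> *\<^sub>R u n \<omega>) \<in> A" for n using u by (simp add: C_def)
        show "AE \<omega> in M. (\<lambda>n. w \<omega> *\<^sub>R u n \<omega>) \<longlonglongrightarrow> w \<omega> *\<^sub>R v \<omega>"
          using lim by eventually_elim (intro tendsto_intros)
      qed (use v w in simp)
      thus ?thesis using v by (simp add: C_def)
    qed
    show "sc f \<in> borel_measurable G" by (rule sc_G[OF f(1)])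
    show "integrable M (\<lambda>\<omega>. norm (sc f \<omega>) ^ 2)" by (rule sc_L2[OF f(1,2)])
    show "sc f \<notin> C" using sc_C[OF f(1)] f(3) by simp
    fix y assume y: "y \<in> borel_measurable G" "integrable M (\<lambda>\<omega>. norm (y \<omega>) ^ 2)"
      and pos: "0 < (\<integral>\<omega>. sc f \<omega> \<bullet> y \<omega> \<partial>M)"
      and neg: "\<And>v. v \<in> C \<Longrightarrow> integrable M (\<lambda>\<omega>. norm (v \<omega>) ^ 2) \<Longrightarrow> (\<integral>\<omega>. v \<omega> \<bullet> y \<omega> \<partial>M) \<le> 0"
    \<comment> \<open>Scaling is symmetric for the inner product, so the required density is the
      separating \<open>y\<close> divided by \<open>w\<close>; its weighted norm is just
      \<open>norm (y \<omega>)\<close>.\<close>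
    have swap: "X \<omega> \<bullet> sc y \<omega> = sc X \<omega> \<bullet> y \<omega>" for X \<omega> by (simp add: sc_def)
    show thesis
    proof (rule that[of "sc y"])
      show "sc y \<in> borel_measurable G" by (rule sc_G[OF y(1)])
      have "integrable M (\<lambda>\<omega>. norm (y \<omega>))"
        using L1_norm_le_of_L2(1)[OF measurable_from_subalg[OF M(2) y(1)] y(2)] by simp
      thus "integrable M (\<lambda>\<omega>. w \<omega> * norm (sc y \<omega>))"
        using w0 by (simp add: sc_def less_imp_le less_imp_neq[symmetric])
      show "0 < (\<integral>\<omega>. f \<omega> \<bullet> sc y \<omega> \<partial>M)" unfolding swap by (rule pos)
      show "(\<integral>\<omega>. X \<omega> \<bullet> sc y \<omega> \<partial>M) \<le> 0" if X: "X \<in> A" "\<And>\<omega>. norm (X \<omega>) \<le> b * w \<omega>" for X b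
        unfolding swap
      proof (rule neg)
        have "X \<in> borel_measurable G" using X AG by blast
        thus "sc X \<in> C" "integrable M (\<lambda>\<omega>. norm (sc X \<omega>) ^ 2)"
          using sc_C X(1) sc_L2[OF _ X(2)] by auto
      qed
    qed
  qed
qed

subsection \<open>The market\<close>

lemma convex_cone_sum:
  assumes "convex_cone S" "finite I" "\<And>i. i \<in> I \<Longrightarrow> f i \<in> S"
  shows "(\<Sum>i\<in>I. f i) \<in> S"
  using assms(2,3)
  by (induction I rule: finite_induct)
    (auto intro: convex_cone_add[OF assms(1)] simp: convex_cone_contains_0[OF assms(1)])

lemma convex_cone_solvency_cone: "convex_cone (solvency_cone P)"
  unfolding solvency_cone_def by (rule convex_cone_convex_cone_hull)

lemma convex_cone_neg_cone: "convex_cone (neg_cone P)"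
  unfolding neg_cone_def
  by (intro convex_cone_linear_image conjI convex_cone_solvency_cone) (simp add: linear_iff)

lemma axis_in_solvency_cone: "axis i 1 \<in> solvency_cone P"
  unfolding solvency_cone_def by (rule hull_inc) blast

lemma exchange_in_solvency_cone: "(P $ i $ j) *\<^sub>R axis i 1 - axis j 1 \<in> solvency_cone P"
  unfolding solvency_cone_def by (rule hull_inc) (auto intro!: image_eqI[of _ _ "(i, j)"])

lemma solvency_cone_scaleR: "x \<in> solvency_cone P \<Longrightarrow> 0 \<le> c \<Longrightarrow> c *\<^sub>R x \<in> solvency_cone P"
  using convex_cone_solvency_cone[of P] by (simp add: convex_cone_iff)

text \<open>Free disposal: the generators \<open>axis i 1\<close> let any amount of an asset be
  thrown away. This turns componentwise domination into attainability.\<close>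

lemma nonpos_in_neg_cone:
  assumes "\<And>i. x $ i \<le> 0"
  shows "x \<in> neg_cone P"
proof -
  have "(\<Sum>i\<in>UNIV. (- x) $ i *\<^sub>R axis i 1) \<in> solvency_cone P"
  proof (rule convex_cone_sum[OF convex_cone_solvency_cone finite])
    show "(- x) $ i *\<^sub>R axis i 1 \<in> solvency_cone P" for i
      using assms[of i] by (intro solvency_cone_scaleR axis_in_solvency_cone) simp
  qed
  hence "- x \<in> solvency_cone P" by (subst vec_eq_sum_axis)
  thus ?thesis unfolding neg_cone_def by (rule image_eqI[rotated]) simp
qed

text \<open>A half-space through 0 is a convex cone, so by minimality of the hull it is enough to
  test the generators.\<close>

lemma polar_neg_coneI:
  fixes y :: "real^'n"
  assumes "\<And>i. 0 \<le> y $ i" "\<And>i j. y $ j \<le> P $ i $ j * y $ i"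
  shows "y \<in> polar_cone (neg_cone P)"
proof -
  have "solvency_cone P \<subseteq> {x. y \<bullet> x \<ge> 0}"
    unfolding solvency_cone_def
    by (rule hull_minimal) (use assms in \<open>auto simp: inner_diff_right inner_axis convex_cone_halfspace_ge\<close>)
  thus ?thesis by (auto simp: polar_cone_def neg_cone_def)
qed

locale bid_ask_market =
  fixes M :: "'a measure" and F :: "nat \<Rightarrow> 'a measure" and T :: nat
    and \<pi> :: "nat \<Rightarrow> 'a \<Rightarrow> real^'n^'n"
  assumes filtered: "filtered_prob_space M F T"
    and bid_ask: "bid_ask_process M F T \<pi>"
begin

sublocale prob_space M
  using filtered by (simp add: filtered_prob_space_def)

lemma subalg: "t \<le> T \<Longrightarrow> subalgebra M (F t)"
  using filtered by (simp add: filtered_prob_space_def)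

lemma subalg_mono: "s \<le> t \<Longrightarrow> t \<le> T \<Longrightarrow> subalgebra (F t) (F s)"
  using filtered subalg[of s] subalg[of t] by (auto simp: filtered_prob_space_def subalgebra_def)

lemma measurable_F_M: "t \<le> T \<Longrightarrow> X \<in> borel_measurable (F t) \<Longrightarrow> X \<in> borel_measurable M"
  using measurable_from_subalg[OF subalg] .

lemma measurable_F_mono:
  "s \<le> t \<Longrightarrow> t \<le> T \<Longrightarrow> X \<in> borel_measurable (F s) \<Longrightarrow> X \<in> borel_measurable (F t)"
  using measurable_from_subalg[OF subalg_mono] .

lemma space_F: "t \<le> T \<Longrightarrow> space (F t) = space M"
  using subalg[of t] by (simp add: subalgebra_def)

lemma finite_measure_subalg: "t \<le> T \<Longrightarrow> finite_measure_subalgebra M (F t)"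
  using subalg finite_measure_axioms
  by (simp add: finite_measure_subalgebra_def finite_measure_subalgebra_axioms_def)

lemma \<pi>_measurable: "t \<le> T \<Longrightarrow> \<pi> t \<in> borel_measurable (F t)"
  using bid_ask by (simp add: bid_ask_process_def adapted_def)

lemma \<pi>_pos: "t \<le> T \<Longrightarrow> \<omega> \<in> space M \<Longrightarrow> 0 < \<pi> t \<omega> $ i $ j"
  using bid_ask by (simp add: bid_ask_process_def bid_ask_matrix_def)

abbreviation "\<A> \<equiv> attainable M F T \<pi>"

lemma trades_measurable: "\<xi> \<in> trades M F \<pi> t \<Longrightarrow> \<xi> \<in> borel_measurable (F t)"
  by (simp add: trades_def L0_in_def)

lemma trades_AE: "\<xi> \<in> trades M F \<pi> t \<Longrightarrow> AE \<omega> in M. \<xi> \<omega> \<in> neg_cone (\<pi> t \<omega>)"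
  by (simp add: trades_def L0_in_def)

lemma tradesI:
  "\<xi> \<in> borel_measurable (F t) \<Longrightarrow> AE \<omega> in M. \<xi> \<omega> \<in> neg_cone (\<pi> t \<omega>) \<Longrightarrow> \<xi> \<in> trades M F \<pi> t"
  by (simp add: trades_def L0_in_def)

lemma trades_add:
  assumes "\<xi> \<in> trades M F \<pi> t" "\<zeta> \<in> trades M F \<pi> t"
  shows "(\<lambda>\<omega>. \<xi> \<omega> + \<zeta> \<omega>) \<in> trades M F \<pi> t"
proof (rule tradesI)
  show "(\<lambda>\<omega>. \<xi> \<omega> + \<zeta> \<omega>) \<in> borel_measurable (F t)"
    using assms by (auto dest!: trades_measurable)
  show "AE \<omega> in M. \<xi> \<omega> + \<zeta> \<omega> \<in> neg_cone (\<pi> t \<omega>)"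
    using trades_AE[OF assms(1)] trades_AE[OF assms(2)]
    by eventually_elim (rule convex_cone_add[OF convex_cone_neg_cone])
qed

lemma trades_scale:
  assumes "\<xi> \<in> trades M F \<pi> t" "0 \<le> c"
  shows "(\<lambda>\<omega>. c *\<^sub>R \<xi> \<omega>) \<in> trades M F \<pi> t"
proof (rule tradesI)
  show "(\<lambda>\<omega>. c *\<^sub>R \<xi> \<omega>) \<in> borel_measurable (F t)"
    using assms by (auto dest!: trades_measurable)
  show "AE \<omega> in M. c *\<^sub>R \<xi> \<omega> \<in> neg_cone (\<pi> t \<omega>)"
    using trades_AE[OF assms(1)]
    by eventually_elim (rule conic_mul[OF _ _ assms(2)],
        use convex_cone_neg_cone in \<open>auto simp: convex_cone_def\<close>)
qed

lemma trades_zero: "(\<lambda>_. 0) \<in> trades M F \<pi> t"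
  by (rule tradesI) (auto simp: convex_cone_contains_0[OF convex_cone_neg_cone])

lemma trades_sum_measurable:
  assumes "\<And>s. s \<le> T \<Longrightarrow> \<xi> s \<in> trades M F \<pi> s" "t \<le> T"
  shows "(\<lambda>\<omega>. \<Sum>s\<le>t. \<xi> s \<omega>) \<in> borel_measurable (F t)"
proof (rule borel_measurable_sum)
  show "\<xi> s \<in> borel_measurable (F t)" if "s \<in> {..t}" for s
    using that assms by (intro measurable_F_mono[of s t] trades_measurable) auto
qed

section \<open>The convex cone of attainable claims\<close>

lemma attainableI:
  assumes "X \<in> borel_measurable (F T)" "\<And>t. t \<le> T \<Longrightarrow> \<xi> t \<in> trades M F \<pi> t"
    "AE \<omega> in M. X \<omega> = (\<Sum>t\<le>T. \<xi> t \<omega>)"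
  shows "X \<in> \<A>"
  using assms unfolding attainable_def by blast

lemma attainableE:
  assumes "X \<in> \<A>"
  obtains \<xi> where "X \<in> borel_measurable (F T)" "\<And>t. t \<le> T \<Longrightarrow> \<xi> t \<in> trades M F \<pi> t"
    "AE \<omega> in M. X \<omega> = (\<Sum>t\<le>T. \<xi> t \<omega>)"
  using assms unfolding attainable_def by blast

lemma attainable_add:
  assumes "X \<in> \<A>" "Y \<in> \<A>"
  shows "(\<lambda>\<omega>. X \<omega> + Y \<omega>) \<in> \<A>"
proof -
  from assms(1) obtain \<xi> where X: "X \<in> borel_measurable (F T)"
    "\<And>t. t \<le> T \<Longrightarrow> \<xi> t \<in> trades M F \<pi> t" "AE \<omega> in M. X \<omega> = (\<Sum>t\<le>T. \<xi> t \<omega>)"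
    by (rule attainableE) blast
  from assms(2) obtain \<zeta> where Y: "Y \<in> borel_measurable (F T)"
    "\<And>t. t \<le> T \<Longrightarrow> \<zeta> t \<in> trades M F \<pi> t" "AE \<omega> in M. Y \<omega> = (\<Sum>t\<le>T. \<zeta> t \<omega>)"
    by (rule attainableE) blast
  show ?thesis
  proof (rule attainableI[of _ "\<lambda>t \<omega>. \<xi> t \<omega> + \<zeta> t \<omega>"])
    show "AE \<omega> in M. X \<omega> + Y \<omega> = (\<Sum>t\<le>T. \<xi> t \<omega> + \<zeta> t \<omega>)"
      using X(3) Y(3) by eventually_elim (simp add: sum.distrib)
  qed (use X Y in \<open>auto intro: trades_add\<close>)
qed

lemma attainable_scale:
  assumes "X \<in> \<A>" "0 \<le> c"
  shows "(\<lambda>\<omega>. c *\<^sub>R X \<omega>) \<in> \<A>"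
proof -
  from assms(1) obtain \<xi> where X: "X \<in> borel_measurable (F T)"
    "\<And>t. t \<le> T \<Longrightarrow> \<xi> t \<in> trades M F \<pi> t" "AE \<omega> in M. X \<omega> = (\<Sum>t\<le>T. \<xi> t \<omega>)"
    by (rule attainableE) blast
  show ?thesis
  proof (rule attainableI[of _ "\<lambda>t \<omega>. c *\<^sub>R \<xi> t \<omega>"])
    show "AE \<omega> in M. c *\<^sub>R X \<omega> = (\<Sum>t\<le>T. c *\<^sub>R \<xi> t \<omega>)"
      using X(3) by eventually_elim (simp add: scaleR_sum_right)
  qed (use X assms(2) in \<open>auto intro: trades_scale\<close>)
qed

lemma trades_attainable:
  assumes "t \<le> T" "\<xi> \<in> trades M F \<pi> t"
  shows "\<xi> \<in> \<A>"
proof (rule attainableI[of _ "\<lambda>s. if s = t then \<xi> else (\<lambda>_. 0)"])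
  show "\<xi> \<in> borel_measurable (F T)"
    using assms by (intro measurable_F_mono[of t T] trades_measurable) auto
  have "(\<Sum>s\<le>T. (if s = t then \<xi> else (\<lambda>_. 0)) \<omega>) = \<xi> \<omega>" for \<omega>
    using assms(1) by (simp add: if_distribR sum.delta cong: if_cong)
  thus "AE \<omega> in M. \<xi> \<omega> = (\<Sum>s\<le>T. (if s = t then \<xi> else (\<lambda>_. 0)) \<omega>)" by simp
qed (use assms trades_zero in auto)

lemma attainable_zero: "(\<lambda>_. 0) \<in> \<A>"
  by (rule trades_attainable[OF le_refl trades_zero])

text \<open>Trades are the increments of a self-financing process, and the process is their running
  sum; the case \<open>t = 0\<close> encodes the empty initial position. The excess of
  \<open>\<eta> T\<close> over \<open>\<theta>\<close> is discarded by one further trade at date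
  \<open>T\<close>.\<close>

lemma superreplication_iff_attainable:
  assumes "\<theta> \<in> borel_measurable (F T)"
  shows "(\<exists>\<eta>. self_financing M F T \<pi> \<eta> \<and> (AE \<omega> in M. \<forall>i. \<theta> \<omega> $ i \<le> \<eta> T \<omega> $ i)) \<longleftrightarrow> \<theta> \<in> \<A>"
proof
  assume "\<exists>\<eta>. self_financing M F T \<pi> \<eta> \<and> (AE \<omega> in M. \<forall>i. \<theta> \<omega> $ i \<le> \<eta> T \<omega> $ i)"
  then obtain \<eta> where \<eta>: "self_financing M F T \<pi> \<eta>" and le: "AE \<omega> in M. \<forall>i. \<theta> \<omega> $ i \<le> \<eta> T \<omega> $ i"
    by blast
  define \<xi> where "\<xi> t \<omega> = \<eta> t \<omega> - (if t = 0 then 0 else \<eta> (t - 1) \<omega>)" for t \<omega>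
  have \<xi>: "\<xi> t \<in> trades M F \<pi> t" if "t \<le> T" for t
    using \<eta> that unfolding self_financing_def \<xi>_def by blast
  have sum: "(\<Sum>s\<le>t. \<xi> s \<omega>) = \<eta> t \<omega>" for t \<omega>
    by (induction t) (simp_all add: \<xi>_def)
  have \<eta>T: "\<eta> T \<in> borel_measurable (F T)"
    using \<eta> by (simp add: self_financing_def adapted_def)
  have "\<eta> T \<in> \<A>"
    by (rule attainableI[OF \<eta>T \<xi>]) (simp_all add: sum)
  moreover have "(\<lambda>\<omega>. \<theta> \<omega> - \<eta> T \<omega>) \<in> \<A>"
  proof (rule trades_attainable[OF le_refl], rule tradesI)
    show "AE \<omega> in M. \<theta> \<omega> - \<eta> T \<omega> \<in> neg_cone (\<pi> T \<omega>)"
      using le by eventually_elim (auto intro: nonpos_in_neg_cone)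
  qed (use \<eta>T assms in simp)
  ultimately show "\<theta> \<in> \<A>"
    by (auto dest: attainable_add)
next
  assume "\<theta> \<in> \<A>"
  then obtain \<xi> where \<xi>: "\<And>t. t \<le> T \<Longrightarrow> \<xi> t \<in> trades M F \<pi> t"
    and eq: "AE \<omega> in M. \<theta> \<omega> = (\<Sum>t\<le>T. \<xi> t \<omega>)"
    by (rule attainableE) blast
  define \<eta> where "\<eta> t \<omega> = (\<Sum>s\<le>t. \<xi> s \<omega>)" for t \<omega>
  have "(\<lambda>\<omega>. \<eta> t \<omega> - (if t = 0 then 0 else \<eta> (t - 1) \<omega>)) = \<xi> t" for t
    by (cases t) (simp_all add: \<eta>_def)
  moreover have "\<eta> t \<in> borel_measurable (F t)" if "t \<le> T" for t
    using trades_sum_measurable[OF \<xi> that] by (simp add: \<eta>_def[abs_def])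
  ultimately have "self_financing M F T \<pi> \<eta>"
    using \<xi> by (simp add: self_financing_def adapted_def)
  moreover have "AE \<omega> in M. \<forall>i. \<theta> \<omega> $ i \<le> \<eta> T \<omega> $ i"
    using eq by eventually_elim (simp add: \<eta>_def)
  ultimately show "\<exists>\<eta>. self_financing M F T \<pi> \<eta> \<and> (AE \<omega> in M. \<forall>i. \<theta> \<omega> $ i \<le> \<eta> T \<omega> $ i)"
    by blast
qed

end

subsection \<open>Superreplicable claims have nonpositive price\<close>

text \<open>The majorant controls the positive part and the hypothesis the negative part. Polar
  inequalities bound values from above only, so this one-sided form is the one that arises.\<close>

lemma integrable_of_integrable_above:
  fixes X Y :: "'a \<Rightarrow> real"
  assumes [measurable]: "X \<in> borel_measurable M" and le: "AE \<omega> in M. X \<omega> \<le> Y \<omega>"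
    and Y: "integrable M Y" and neg: "integrable M (\<lambda>\<omega>. max 0 (- X \<omega>))"
  shows "integrable M X" "(\<integral>\<omega>. X \<omega> \<partial>M) \<le> (\<integral>\<omega>. Y \<omega> \<partial>M)"
proof -
  show int: "integrable M X"
  proof (rule Bochner_Integration.integrable_bound)
    show "integrable M (\<lambda>\<omega>. \<bar>Y \<omega>\<bar> + max 0 (- X \<omega>))" using Y neg by simp
    show "AE \<omega> in M. norm (X \<omega>) \<le> norm (\<bar>Y \<omega>\<bar> + max 0 (- X \<omega>))"
      using le by eventually_elim auto
  qed simp
  show "(\<integral>\<omega>. X \<omega> \<partial>M) \<le> (\<integral>\<omega>. Y \<omega> \<partial>M)" by (rule integral_mono_AE[OF int Y le])
qed

lemma integrable_inner_bounded:
  fixes X Y :: "'a \<Rightarrow> 'b::euclidean_space"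
  assumes [measurable]: "X \<in> borel_measurable M" and Y: "integrable M Y"
    and b: "\<And>\<omega>. norm (X \<omega>) \<le> b"
  shows "integrable M (\<lambda>\<omega>. X \<omega> \<bullet> Y \<omega>)"
proof (rule Bochner_Integration.integrable_bound)
  show "integrable M (\<lambda>\<omega>. b * norm (Y \<omega>))" using Y by simp
  have "\<bar>X \<omega> \<bullet> Y \<omega>\<bar> \<le> b * norm (Y \<omega>)" for \<omega>
    using Cauchy_Schwarz_ineq2[of "X \<omega>" "Y \<omega>"] mult_right_mono[OF b[of \<omega>] norm_ge_zero[of "Y \<omega>"]]
    by linarith
  thus "AE \<omega> in M. norm (X \<omega> \<bullet> Y \<omega>) \<le> norm (b * norm (Y \<omega>))"
    by (intro AE_I2) (simp add: order_trans[OF _ abs_ge_self])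
  show "(\<lambda>\<omega>. X \<omega> \<bullet> Y \<omega>) \<in> borel_measurable M" using borel_measurable_integrable[OF Y] by simp
qed

context bid_ask_market
begin

lemma vec_martingaleD:
  assumes "vec_martingale M F T Z"
  shows "t \<le> T \<Longrightarrow> Z t \<in> borel_measurable (F t)"
    "t \<le> T \<Longrightarrow> integrable M (Z t)"
    "s \<le> t \<Longrightarrow> t \<le> T \<Longrightarrow> AE \<omega> in M. real_cond_exp M (F s) (\<lambda>\<omega>'. Z t \<omega>' $ i) \<omega> = Z s \<omega> $ i"
  using assms by (auto simp: vec_martingale_def adapted_def)

text \<open>The factor known at date \<open>s\<close> is pulled out of the conditional expectation
  in each component; its boundedness makes the products integrable.\<close>

lemma martingale_inner_bounded:
  assumes Z: "vec_martingale M F T Z" and st: "s \<le> t" "t \<le> T"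
    and X: "X \<in> borel_measurable (F s)" "\<And>\<omega>. norm (X \<omega>) \<le> b"
  shows "(\<integral>\<omega>. X \<omega> \<bullet> Z t \<omega> \<partial>M) = (\<integral>\<omega>. X \<omega> \<bullet> Z s \<omega> \<partial>M)"
proof -
  have sT: "s \<le> T" using st by simp
  interpret S: finite_measure_subalgebra M "F s" by (rule finite_measure_subalg[OF sT])
  have int: "integrable M (\<lambda>\<omega>. X \<omega> $ i * Z r \<omega> $ i)" if "r \<le> T" for r i
  proof (rule Bochner_Integration.integrable_bound)
    show "integrable M (\<lambda>\<omega>. b * Z r \<omega> $ i)"
      using integrable_vec_nth[OF vec_martingaleD(2)[OF Z that]] by simp
    have "\<bar>X \<omega> $ i\<bar> \<le> \<bar>b\<bar>" for \<omega>
      using component_le_norm_cart[of "X \<omega>" i] X(2)[of \<omega>] by linarith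
    thus "AE \<omega> in M. norm (X \<omega> $ i * Z r \<omega> $ i) \<le> norm (b * Z r \<omega> $ i)"
      by (intro AE_I2) (simp add: abs_mult mult_right_mono)
    show "(\<lambda>\<omega>. X \<omega> $ i * Z r \<omega> $ i) \<in> borel_measurable M"
      using measurable_F_M[OF sT X(1)] measurable_F_M[OF that vec_martingaleD(1)[OF Z that]] by simp
  qed
  have eq: "(\<integral>\<omega>. X \<omega> $ i * Z t \<omega> $ i \<partial>M) = (\<integral>\<omega>. X \<omega> $ i * Z s \<omega> $ i \<partial>M)" for i
  proof -
    have Zt: "(\<lambda>\<omega>. Z t \<omega> $ i) \<in> borel_measurable M"
      using integrable_vec_nth[OF vec_martingaleD(2)[OF Z st(2)]] by simp
    have Xi: "(\<lambda>\<omega>. X \<omega> $ i) \<in> borel_measurable (F s)" using X(1) by simp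
    have "(\<integral>\<omega>. X \<omega> $ i * Z t \<omega> $ i \<partial>M)
        = (\<integral>\<omega>. X \<omega> $ i * real_cond_exp M (F s) (\<lambda>\<omega>'. Z t \<omega>' $ i) \<omega> \<partial>M)"
      using S.real_cond_exp_intg(2)[OF int[OF st(2)] Xi Zt] by simp
    also have "\<dots> = (\<integral>\<omega>. X \<omega> $ i * Z s \<omega> $ i \<partial>M)"
    proof (rule integral_cong_AE)
      show "AE \<omega> in M. X \<omega> $ i * real_cond_exp M (F s) (\<lambda>\<omega>'. Z t \<omega>' $ i) \<omega> = X \<omega> $ i * Z s \<omega> $ i"
        using vec_martingaleD(3)[OF Z st, of i] by eventually_elim simp
      show "(\<lambda>\<omega>. X \<omega> $ i * real_cond_exp M (F s) (\<lambda>\<omega>'. Z t \<omega>' $ i) \<omega>) \<in> borel_measurable M"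
        using S.real_cond_exp_intg(1)[OF int[OF st(2)] Xi Zt] by simp
      show "(\<lambda>\<omega>. X \<omega> $ i * Z s \<omega> $ i) \<in> borel_measurable M"
        using int[OF sT] by simp
    qed
    finally show ?thesis .
  qed
  have "(\<integral>\<omega>. X \<omega> \<bullet> Z r \<omega> \<partial>M) = (\<Sum>i\<in>UNIV. \<integral>\<omega>. X \<omega> $ i * Z r \<omega> $ i \<partial>M)" if "r \<le> T" for r
    unfolding inner_vec_def inner_real_def using int[OF that] by simp
  thus ?thesis using eq st sT by simp
qed

text \<open>The formal identity \<open>E[X \<bullet> Z t | F s] = X \<bullet> Z s\<close> is
  available on events of \<open>F s\<close> on which \<open>X\<close> is bounded. The first claim is
  Jensen's inequality for the negative part; the others carry integrability and the mean from
  \<open>s\<close> to \<open>t\<close> once the negative part at \<open>t\<close> is under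
  control.\<close>

lemma martingale_inner:
  assumes Z: "vec_martingale M F T Z" and st: "s \<le> t" "t \<le> T"
    and X [measurable]: "X \<in> borel_measurable (F s)"
    and neg: "integrable M (\<lambda>\<omega>. max 0 (- (X \<omega> \<bullet> Z t \<omega>)))"
  shows "integrable M (\<lambda>\<omega>. max 0 (- (X \<omega> \<bullet> Z s \<omega>)))"
    and "integrable M (\<lambda>\<omega>. X \<omega> \<bullet> Z s \<omega>) \<Longrightarrow> integrable M (\<lambda>\<omega>. X \<omega> \<bullet> Z t \<omega>)"
    and "integrable M (\<lambda>\<omega>. X \<omega> \<bullet> Z s \<omega>) \<Longrightarrow>
      (\<integral>\<omega>. X \<omega> \<bullet> Z t \<omega> \<partial>M) = (\<integral>\<omega>. X \<omega> \<bullet> Z s \<omega> \<partial>M)"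
proof -
  have sT: "s \<le> T" using st by simp
  have Zs [measurable]: "Z s \<in> borel_measurable (F s)" by (rule vec_martingaleD(1)[OF Z sT])
  have XM [measurable]: "X \<in> borel_measurable M" by (rule measurable_F_M[OF sT X])
  have ZM [measurable]: "Z s \<in> borel_measurable M" "Z t \<in> borel_measurable M"
    using vec_martingaleD(2)[OF Z sT] vec_martingaleD(2)[OF Z st(2)] by simp_all
  \<comment> \<open>The sets \<open>B n\<close> exhaust the space. The sets \<open>N n\<close> also
    fix the sign of \<open>X \<bullet> Z s\<close>, which is known at date \<open>s\<close>, and so
    isolate the negative part by an event of \<open>F s\<close>.\<close>
  define B where "B n = {\<omega> \<in> space (F s). norm (X \<omega>) \<le> real n}" for n
  define N where "N n = {\<omega> \<in> space (F s). norm (X \<omega>) \<le> real n \<and> X \<omega> \<bullet> Z s \<omega> < 0}" for n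
  have BF: "B n \<in> sets (F s)" and NF: "N n \<in> sets (F s)" for n
    unfolding B_def N_def by measurable
  have trunc: "(\<integral>\<omega>. (c * indicator S \<omega>) *\<^sub>R X \<omega> \<bullet> Z t \<omega> \<partial>M)
        = (\<integral>\<omega>. (c * indicator S \<omega>) *\<^sub>R X \<omega> \<bullet> Z s \<omega> \<partial>M)"
    "r \<le> T \<Longrightarrow> integrable M (\<lambda>\<omega>. (c * indicator S \<omega>) *\<^sub>R X \<omega> \<bullet> Z r \<omega>)"
    if S: "S \<in> sets (F s)" "S \<subseteq> B n" for c S n r
  proof -
    have bd: "norm ((c * indicator S \<omega>) *\<^sub>R X \<omega>) \<le> \<bar>c\<bar> * real n" for \<omega>
      using S(2) by (auto simp: B_def abs_mult indicator_def intro: mult_left_mono)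
    have ms: "(\<lambda>\<omega>. (c * indicator S \<omega>) *\<^sub>R X \<omega>) \<in> borel_measurable (F s)"
      using S(1) by measurable
    show "(\<integral>\<omega>. (c * indicator S \<omega>) *\<^sub>R X \<omega> \<bullet> Z t \<omega> \<partial>M)
        = (\<integral>\<omega>. (c * indicator S \<omega>) *\<^sub>R X \<omega> \<bullet> Z s \<omega> \<partial>M)"
      by (rule martingale_inner_bounded[OF Z st ms bd])
    show "integrable M (\<lambda>\<omega>. (c * indicator S \<omega>) *\<^sub>R X \<omega> \<bullet> Z r \<omega>)" if "r \<le> T"
      by (rule integrable_inner_bounded[OF measurable_F_M[OF sT ms] vec_martingaleD(2)[OF Z that] bd])
  qed
  \<comment> \<open>Each point lies in all late \<open>B n\<close>, so the truncated integrands are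
    eventually constant in \<open>n\<close>.\<close>
  have ind: "\<forall>\<^sub>F n in sequentially. indicator (B n) \<omega> = (1::real)" if "\<omega> \<in> space M" for \<omega>
  proof -
    obtain m :: nat where "norm (X \<omega>) \<le> real m" using real_arch_simple by blast
    hence "\<forall>n\<ge>m. indicator (B n) \<omega> = (1::real)"
      using that space_F[OF sT] by (auto simp: B_def indicator_def intro: order_trans)
    thus ?thesis by (auto simp: eventually_sequentially)
  qed
  have NB: "indicator (N n) \<omega> * (- (X \<omega> \<bullet> Z s \<omega>)) = indicator (B n) \<omega> * max 0 (- (X \<omega> \<bullet> Z s \<omega>))"
    for n \<omega>
    by (auto simp: N_def B_def indicator_def max_def)
  show "integrable M (\<lambda>\<omega>. max 0 (- (X \<omega> \<bullet> Z s \<omega>)))"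
  proof (rule integral_Fatou(1))
    show "integrable M (\<lambda>\<omega>. (- 1 * indicator (N n) \<omega>) *\<^sub>R X \<omega> \<bullet> Z s \<omega>)" for n
      by (rule trunc(2)[OF NF _ sT]) (auto simp: N_def B_def)
    show "AE \<omega> in M. 0 \<le> (- 1 * indicator (N n) \<omega>) *\<^sub>R X \<omega> \<bullet> Z s \<omega>" for n
      using NB[of n] by (auto simp: indicator_def N_def)
    show "AE \<omega> in M. (\<lambda>n. (- 1 * indicator (N n) \<omega>) *\<^sub>R X \<omega> \<bullet> Z s \<omega>)
        \<longlonglongrightarrow> max 0 (- (X \<omega> \<bullet> Z s \<omega>))"
    proof (rule AE_I2)
      fix \<omega> assume "\<omega> \<in> space M"
      from ind[OF this] show "(\<lambda>n. (- 1 * indicator (N n) \<omega>) *\<^sub>R X \<omega> \<bullet> Z s \<omega>)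
          \<longlonglongrightarrow> max 0 (- (X \<omega> \<bullet> Z s \<omega>))"
        using NB[of _ \<omega>] by (intro tendsto_eventually) (auto elim: eventually_mono)
    qed
    show "(\<integral>\<omega>. (- 1 * indicator (N n) \<omega>) *\<^sub>R X \<omega> \<bullet> Z s \<omega> \<partial>M)
        \<le> (\<integral>\<omega>. max 0 (- (X \<omega> \<bullet> Z t \<omega>)) \<partial>M)" for n
    proof -
      have NB': "N n \<subseteq> B n" by (auto simp: N_def B_def)
      \<comment> \<open>Moved from date \<open>s\<close> to date \<open>t\<close>, the integrand is
        at most the negative part of \<open>X \<bullet> Z t\<close>, a bound that does not depend on
        \<open>n\<close>.\<close>
      have "(\<integral>\<omega>. (- 1 * indicator (N n) \<omega>) *\<^sub>R X \<omega> \<bullet> Z t \<omega> \<partial>M)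
          \<le> (\<integral>\<omega>. max 0 (- (X \<omega> \<bullet> Z t \<omega>)) \<partial>M)"
        by (rule integral_mono[OF trunc(2)[OF NF NB' st(2)] neg]) (auto simp: indicator_def)
      thus ?thesis using trunc(1)[OF NF NB', of "-1"] by simp
    qed
  qed (rule tendsto_const | simp)+
  assume W: "integrable M (\<lambda>\<omega>. X \<omega> \<bullet> Z s \<omega>)"
  have pos: "integrable M (\<lambda>\<omega>. max 0 (X \<omega> \<bullet> Z t \<omega>))"
  proof (rule integral_Fatou(1))
    let ?f = "\<lambda>n \<omega>. (1 * indicator (B n) \<omega>) *\<^sub>R X \<omega> \<bullet> Z t \<omega>"
    have int: "integrable M (?f n)" for n by (rule trunc(2)[OF BF order_refl st(2)])
    show intm: "integrable M (\<lambda>\<omega>. max 0 (?f n \<omega>))" for n using int[of n] by simp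
    show "AE \<omega> in M. (\<lambda>n. max 0 (?f n \<omega>)) \<longlonglongrightarrow> max 0 (X \<omega> \<bullet> Z t \<omega>)"
    proof (rule AE_I2)
      fix \<omega> assume "\<omega> \<in> space M"
      from ind[OF this] show "(\<lambda>n. max 0 (?f n \<omega>)) \<longlonglongrightarrow> max 0 (X \<omega> \<bullet> Z t \<omega>)"
        by (intro tendsto_eventually) (auto elim: eventually_mono)
    qed
    show "(\<integral>\<omega>. max 0 (?f n \<omega>) \<partial>M)
        \<le> (\<integral>\<omega>. \<bar>X \<omega> \<bullet> Z s \<omega>\<bar> \<partial>M) + (\<integral>\<omega>. max 0 (- (X \<omega> \<bullet> Z t \<omega>)) \<partial>M)" for n
    proof -
      \<comment> \<open>The positive part is the value plus the negative part. The mean of the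
        truncated value moves to date \<open>s\<close>, where \<open>W\<close> bounds it uniformly
        in \<open>n\<close>.\<close>
      have "(\<integral>\<omega>. max 0 (?f n \<omega>) \<partial>M) \<le> (\<integral>\<omega>. ?f n \<omega> + max 0 (- (X \<omega> \<bullet> Z t \<omega>)) \<partial>M)"
        by (rule integral_mono) (use intm int neg in \<open>auto simp: indicator_def\<close>)
      also have "\<dots> = (\<integral>\<omega>. ?f n \<omega> \<partial>M) + (\<integral>\<omega>. max 0 (- (X \<omega> \<bullet> Z t \<omega>)) \<partial>M)"
        by (rule Bochner_Integration.integral_add[OF int neg])
      also have "(\<integral>\<omega>. ?f n \<omega> \<partial>M) = (\<integral>\<omega>. (1 * indicator (B n) \<omega>) *\<^sub>R X \<omega> \<bullet> Z s \<omega> \<partial>M)"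
        by (rule trunc(1)[OF BF order_refl])
      also have "\<dots> \<le> (\<integral>\<omega>. \<bar>X \<omega> \<bullet> Z s \<omega>\<bar> \<partial>M)"
        by (rule integral_mono[OF trunc(2)[OF BF order_refl sT]]) (use W in \<open>auto simp: indicator_def\<close>)
      finally show ?thesis by simp
    qed
  qed (rule tendsto_const | simp)+
  have "integrable M (\<lambda>\<omega>. max 0 (X \<omega> \<bullet> Z t \<omega>) - max 0 (- (X \<omega> \<bullet> Z t \<omega>)))"
    using pos neg by simp
  moreover have "max 0 x - max 0 (- x) = x" for x :: real by (simp add: max_def)
  ultimately show Y: "integrable M (\<lambda>\<omega>. X \<omega> \<bullet> Z t \<omega>)" by simp
  have lim: "(\<lambda>n. \<integral>\<omega>. (1 * indicator (B n) \<omega>) *\<^sub>R X \<omega> \<bullet> Z r \<omega> \<partial>M) \<longlonglongrightarrow> (\<integral>\<omega>. X \<omega> \<bullet> Z r \<omega> \<partial>M)"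
    if r: "r \<le> T" "integrable M (\<lambda>\<omega>. X \<omega> \<bullet> Z r \<omega>)" for r
  proof (rule integral_dominated_convergence[where w="\<lambda>\<omega>. \<bar>X \<omega> \<bullet> Z r \<omega>\<bar>"])
    show "AE \<omega> in M. (\<lambda>n. (1 * indicator (B n) \<omega>) *\<^sub>R X \<omega> \<bullet> Z r \<omega>) \<longlonglongrightarrow> X \<omega> \<bullet> Z r \<omega>"
    proof (rule AE_I2)
      fix \<omega> assume "\<omega> \<in> space M"
      from ind[OF this] show "(\<lambda>n. (1 * indicator (B n) \<omega>) *\<^sub>R X \<omega> \<bullet> Z r \<omega>) \<longlonglongrightarrow> X \<omega> \<bullet> Z r \<omega>"
        by (intro tendsto_eventually) (auto elim: eventually_mono)
    qed
    show "(\<lambda>\<omega>. (1 * indicator (B n) \<omega>) *\<^sub>R X \<omega> \<bullet> Z r \<omega>) \<in> borel_measurable M" for n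
      using trunc(2)[OF BF order_refl r(1)] by (rule borel_measurable_integrable)
  qed (use r(2) in \<open>auto simp: indicator_def\<close>)
  show "(\<integral>\<omega>. X \<omega> \<bullet> Z t \<omega> \<partial>M) = (\<integral>\<omega>. X \<omega> \<bullet> Z s \<omega> \<partial>M)"
    by (rule LIMSEQ_unique[OF lim[OF st(2) Y]])
      (use lim[OF sT W] trunc(1)[OF BF order_refl, of 1] in simp)
qed

lemma consistent_price_process_polar:
  assumes "consistent_price_process M F T \<pi> Z" "t \<le> T" "\<xi> \<in> trades M F \<pi> t"
  shows "AE \<omega> in M. \<xi> \<omega> \<bullet> Z t \<omega> \<le> 0"
proof -
  have "AE \<omega> in M. Z t \<omega> \<in> polar_cone (neg_cone (\<pi> t \<omega>)) - {0}"
    using assms by (simp add: consistent_price_process_def)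
  thus ?thesis using trades_AE[OF assms(3)]
    by eventually_elim (simp add: polar_cone_def inner_commute)
qed

text \<open>The hypothesis on the negative part travels through the induction. Removing the last
  trade, whose value is nonpositive, can only raise the value, and \<open>martingale_inner\<close>
  takes the integrable negative part down to date \<open>t\<close>. The induction hypothesis
  upgrades it to an integrable value of nonpositive mean, which then climbs back to
  \<open>Suc t\<close>.\<close>

lemma trades_sum_inner:
  assumes Z: "consistent_price_process M F T \<pi> Z"
    and \<xi>: "\<And>s. s \<le> T \<Longrightarrow> \<xi> s \<in> trades M F \<pi> s" and "t \<le> T"
    and "integrable M (\<lambda>\<omega>. max 0 (- ((\<Sum>s\<le>t. \<xi> s \<omega>) \<bullet> Z t \<omega>)))"
  shows "integrable M (\<lambda>\<omega>. (\<Sum>s\<le>t. \<xi> s \<omega>) \<bullet> Z t \<omega>) \<and> (\<integral>\<omega>. (\<Sum>s\<le>t. \<xi> s \<omega>) \<bullet> Z t \<omega> \<partial>M) \<le> 0"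
  using assms(3,4)
proof (induction t)
  case 0
  have mart: "vec_martingale M F T Z" using Z by (simp add: consistent_price_process_def)
  have "\<xi> 0 \<in> borel_measurable M" "Z 0 \<in> borel_measurable M"
    using trades_measurable[OF \<xi>[of 0]] vec_martingaleD(1)[OF mart, of 0] by (auto intro: measurable_F_M[of 0])
  hence m: "(\<lambda>\<omega>. \<xi> 0 \<omega> \<bullet> Z 0 \<omega>) \<in> borel_measurable M" by (rule borel_measurable_inner)
  have neg: "integrable M (\<lambda>\<omega>. max 0 (- (\<xi> 0 \<omega> \<bullet> Z 0 \<omega>)))" using 0(2) by simp
  note base = integrable_of_integrable_above[OF m
      consistent_price_process_polar[OF Z le0 \<xi>[OF le0]] integrable_zero neg]
  show ?case using base by simp
next
  case (Suc t)
  have mart: "vec_martingale M F T Z" using Z by (simp add: consistent_price_process_def)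
  have t: "t \<le> T" "Suc t \<le> T" using Suc.prems by auto
  let ?\<eta> = "\<lambda>t \<omega>. \<Sum>s\<le>t. \<xi> s \<omega>"
  have \<eta>F: "?\<eta> r \<in> borel_measurable (F r)" if "r \<le> T" for r
    by (rule trades_sum_measurable[OF \<xi> that])
  have [measurable]: "?\<eta> t \<in> borel_measurable M" "?\<eta> (Suc t) \<in> borel_measurable M"
    using measurable_F_M[OF _ \<eta>F] t by blast+
  have [measurable]: "Z (Suc t) \<in> borel_measurable M"
    using vec_martingaleD(2)[OF mart t(2)] by simp
  have le: "AE \<omega> in M. ?\<eta> (Suc t) \<omega> \<bullet> Z (Suc t) \<omega> \<le> ?\<eta> t \<omega> \<bullet> Z (Suc t) \<omega>"
    using consistent_price_process_polar[OF Z t(2) \<xi>[OF t(2)]]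
    by eventually_elim (simp add: inner_add_left)
  have neg: "integrable M (\<lambda>\<omega>. max 0 (- (?\<eta> t \<omega> \<bullet> Z (Suc t) \<omega>)))"
  proof (rule Bochner_Integration.integrable_bound[OF Suc.prems(2)])
    show "AE \<omega> in M. norm (max 0 (- (?\<eta> t \<omega> \<bullet> Z (Suc t) \<omega>)))
        \<le> norm (max 0 (- (?\<eta> (Suc t) \<omega> \<bullet> Z (Suc t) \<omega>)))"
      using le by eventually_elim auto
  qed measurable
  note step = martingale_inner[OF mart le_SucI[OF order_refl] t(2) \<eta>F[OF t(1)] neg]
  have IH: "integrable M (\<lambda>\<omega>. ?\<eta> t \<omega> \<bullet> Z t \<omega>)" "(\<integral>\<omega>. ?\<eta> t \<omega> \<bullet> Z t \<omega> \<partial>M) \<le> 0"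
    using Suc.IH[OF t(1) step(1)] by auto
  have m: "(\<lambda>\<omega>. ?\<eta> (Suc t) \<omega> \<bullet> Z (Suc t) \<omega>) \<in> borel_measurable M" by measurable
  from integrable_of_integrable_above[OF m le step(2)[OF IH(1)] Suc.prems(2)] step(3)[OF IH(1)] IH(2)
  show ?case by simp
qed

text \<open>For attainable claims an integrable negative part already forces integrability, so the
  extended expectation is an ordinary integral.\<close>

lemma attainable_inner:
  assumes X: "X \<in> \<A>" and Z: "consistent_price_process M F T \<pi> Z"
    and neg: "integrable M (\<lambda>\<omega>. max 0 (- (X \<omega> \<bullet> Z T \<omega>)))"
  shows "integrable M (\<lambda>\<omega>. X \<omega> \<bullet> Z T \<omega>)" "(\<integral>\<omega>. X \<omega> \<bullet> Z T \<omega> \<partial>M) \<le> 0"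
proof -
  from X obtain \<xi> where XF: "X \<in> borel_measurable (F T)" and \<xi>: "\<And>t. t \<le> T \<Longrightarrow> \<xi> t \<in> trades M F \<pi> t"
    and eq: "AE \<omega> in M. X \<omega> = (\<Sum>t\<le>T. \<xi> t \<omega>)"
    by (rule attainableE) blast
  have mart: "vec_martingale M F T Z" using Z by (simp add: consistent_price_process_def)
  have [measurable]: "X \<in> borel_measurable M" "(\<lambda>\<omega>. \<Sum>t\<le>T. \<xi> t \<omega>) \<in> borel_measurable M"
    "Z T \<in> borel_measurable M"
    using measurable_F_M[OF order_refl] XF trades_sum_measurable[OF \<xi> order_refl]
      vec_martingaleD(1)[OF mart order_refl] by blast+
  have "integrable M (\<lambda>\<omega>. max 0 (- ((\<Sum>t\<le>T. \<xi> t \<omega>) \<bullet> Z T \<omega>)))"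
    by (rule integrable_cong_AE_imp[OF neg]) (use eq in \<open>measurable, auto\<close>)
  note sum = trades_sum_inner[OF Z \<xi> order_refl this]
  show "integrable M (\<lambda>\<omega>. X \<omega> \<bullet> Z T \<omega>)"
    by (rule integrable_cong_AE_imp[OF conjunct1[OF sum]]) (use eq in \<open>measurable, auto\<close>)
  have "(\<integral>\<omega>. X \<omega> \<bullet> Z T \<omega> \<partial>M) = (\<integral>\<omega>. (\<Sum>t\<le>T. \<xi> t \<omega>) \<bullet> Z T \<omega> \<partial>M)"
    by (rule integral_cong_AE) (use eq in \<open>measurable, auto\<close>)
  thus "(\<integral>\<omega>. X \<omega> \<bullet> Z T \<omega> \<partial>M) \<le> 0" using sum by simp
qed

end

subsection \<open>Densities of consistent price processes\<close>

context bid_ask_market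
begin

lemma cond_exp_vec_martingale:
  fixes Y :: "'a \<Rightarrow> real^'m"
  assumes Y: "integrable M Y"
  shows "vec_martingale M F T (\<lambda>t \<omega>. \<chi> i. real_cond_exp M (F t) (\<lambda>\<omega>'. Y \<omega>' $ i) \<omega>)"
  unfolding vec_martingale_def adapted_def
proof (intro conjI allI impI; (elim conjE)?)
  fix t assume "t \<le> T"
  then interpret S: finite_measure_subalgebra M "F t" by (rule finite_measure_subalg)
  show "(\<lambda>\<omega>. (\<chi> i. real_cond_exp M (F t) (\<lambda>\<omega>'. Y \<omega>' $ i) \<omega>) :: real^'m) \<in> borel_measurable (F t)"
    by (intro borel_measurable_vec_lambda) simp
  show "integrable M (\<lambda>\<omega>. (\<chi> i. real_cond_exp M (F t) (\<lambda>\<omega>'. Y \<omega>' $ i) \<omega>) :: real^'m)"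
    by (intro integrable_vec_lambda S.real_cond_exp_int integrable_vec_nth[OF Y])
next
  fix s t and i :: 'm assume st: "s \<le> t" "t \<le> T"
  then interpret S: finite_measure_subalgebra M "F s" by (intro finite_measure_subalg) simp
  show "AE \<omega> in M. real_cond_exp M (F s) (\<lambda>\<omega>'. (\<chi> i. real_cond_exp M (F t) (\<lambda>\<omega>'. Y \<omega>' $ i) \<omega>') $ i) \<omega>
      = (\<chi> i. real_cond_exp M (F s) (\<lambda>\<omega>'. Y \<omega>' $ i) \<omega>) $ i"
    using S.real_cond_exp_nested_subalg[OF subalg[OF st(2)] subalg_mono[OF st] integrable_vec_nth[OF Y]]
    by simp
qed

end

text \<open>The weight \<open>w\<close> makes all claims of order \<open>w\<close> integrable against the densities below.\<close>

locale weighted_market = bid_ask_market M F T \<pi>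
  for M :: "'a measure" and F T and \<pi> :: "nat \<Rightarrow> 'a \<Rightarrow> real^'n^'n" +
  fixes w :: "'a \<Rightarrow> real"
  assumes w_measurable: "w \<in> borel_measurable (F T)"
    and w_ge_1: "1 \<le> w \<omega>"
    and closed_attainable: "closedin (L0_topology M (F T)) \<A>"
    and no_arbitrage: "arbitrage_free M (F T) \<A>"
begin

text \<open>The polar of \<open>\<A>\<close> in a weighted mean norm. Test claims are of order
  \<open>w\<close>, because for others the Bochner integral might take its default value 0. The zero
  density is a member; nonvanishing is secured separately.\<close>

definition dual_densities :: "('a \<Rightarrow> real^'n) set" where
  "dual_densities = {Z \<in> borel_measurable (F T). integrable M (\<lambda>\<omega>. w \<omega> * norm (Z \<omega>)) \<and>
     (\<forall>X\<in>\<A>. \<forall>b. (\<forall>\<omega>. norm (X \<omega>) \<le> b * w \<omega>) \<longrightarrow> (\<integral>\<omega>. X \<omega> \<bullet> Z \<omega> \<partial>M) \<le> 0)}"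

lemma w_pos: "0 < w \<omega>"
  using w_ge_1[of \<omega>] by simp

lemma w_nonneg: "0 \<le> w \<omega>"
  using w_ge_1[of \<omega>] by simp

lemma w_measurable_M: "w \<in> borel_measurable M"
  by (rule measurable_F_M[OF order_refl w_measurable])

lemma dual_densitiesD:
  assumes "Z \<in> dual_densities"
  shows "Z \<in> borel_measurable (F T)" "Z \<in> borel_measurable M"
    "integrable M (\<lambda>\<omega>. w \<omega> * norm (Z \<omega>))"
    "X \<in> \<A> \<Longrightarrow> (\<And>\<omega>. norm (X \<omega>) \<le> b * w \<omega>) \<Longrightarrow> (\<integral>\<omega>. X \<omega> \<bullet> Z \<omega> \<partial>M) \<le> 0"
  using assms measurable_F_M[OF order_refl] unfolding dual_densities_def by blast+

lemma norm_inner_le_weighted: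
  fixes x z :: "real^'n"
  assumes "norm x \<le> b * w \<omega>"
  shows "norm (x \<bullet> z) \<le> b * (w \<omega> * norm z)"
  using Cauchy_Schwarz_ineq2[of x z] mult_right_mono[OF assms norm_ge_zero[of z]]
  by (simp add: mult.assoc)

lemma dual_densities_inner_integrable:
  assumes Z: "Z \<in> dual_densities" and X: "X \<in> borel_measurable M" "\<And>\<omega>. norm (X \<omega>) \<le> b * w \<omega>"
  shows "integrable M (\<lambda>\<omega>. X \<omega> \<bullet> Z \<omega>)"
proof (rule Bochner_Integration.integrable_bound)
  show "integrable M (\<lambda>\<omega>. b * (w \<omega> * norm (Z \<omega>)))" using dual_densitiesD(3)[OF Z] by simp
  show "AE \<omega> in M. norm (X \<omega> \<bullet> Z \<omega>) \<le> norm (b * (w \<omega> * norm (Z \<omega>)))"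
    by (intro AE_I2 order_trans[OF norm_inner_le_weighted[OF X(2)]]) simp
  show "(\<lambda>\<omega>. X \<omega> \<bullet> Z \<omega>) \<in> borel_measurable M"
    using X(1) dual_densitiesD(2)[OF Z] by simp
qed

lemma dual_densities_integrable:
  assumes "Z \<in> dual_densities"
  shows "integrable M Z"
proof (rule Bochner_Integration.integrable_bound[OF dual_densitiesD(3)[OF assms] dual_densitiesD(2)[OF assms]])
  have "norm (Z \<omega>) \<le> w \<omega> * norm (Z \<omega>)" for \<omega>
    using mult_right_mono[OF w_ge_1[of \<omega>] norm_ge_zero[of "Z \<omega>"]] by simp
  thus "AE \<omega> in M. norm (Z \<omega>) \<le> norm (w \<omega> * norm (Z \<omega>))"
    by (intro AE_I2) (simp add: order_trans[OF _ abs_ge_self])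
qed

lemma attainable_measurable: "X \<in> \<A> \<Longrightarrow> X \<in> borel_measurable M"
  using measurable_F_M[OF order_refl] by (auto elim: attainableE)

lemma dual_densities_add_scale:
  assumes Y: "Y \<in> dual_densities" and Z: "Z \<in> dual_densities" and c: "0 \<le> c"
  shows "(\<lambda>\<omega>. Y \<omega> + c *\<^sub>R Z \<omega>) \<in> dual_densities"
  unfolding dual_densities_def
proof (intro CollectI conjI ballI allI impI)
  show m: "(\<lambda>\<omega>. Y \<omega> + c *\<^sub>R Z \<omega>) \<in> borel_measurable (F T)"
    using dual_densitiesD(1)[OF Y] dual_densitiesD(1)[OF Z] by simp
  show "integrable M (\<lambda>\<omega>. w \<omega> * norm (Y \<omega> + c *\<^sub>R Z \<omega>))"
  proof (rule Bochner_Integration.integrable_bound)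
    show "integrable M (\<lambda>\<omega>. w \<omega> * norm (Y \<omega>) + c * (w \<omega> * norm (Z \<omega>)))"
      using dual_densitiesD(3)[OF Y] dual_densitiesD(3)[OF Z] by simp
    have "w \<omega> * norm (Y \<omega> + c *\<^sub>R Z \<omega>) \<le> w \<omega> * norm (Y \<omega>) + c * (w \<omega> * norm (Z \<omega>))" for \<omega>
      using mult_left_mono[OF norm_triangle_ineq[of "Y \<omega>" "c *\<^sub>R Z \<omega>"], of "w \<omega>"] w_pos[of \<omega>] c
      by (simp add: algebra_simps)
    thus "AE \<omega> in M. norm (w \<omega> * norm (Y \<omega> + c *\<^sub>R Z \<omega>))
        \<le> norm (w \<omega> * norm (Y \<omega>) + c * (w \<omega> * norm (Z \<omega>)))"
      using w_nonneg c by (intro AE_I2) (simp add: order_trans[OF _ abs_ge_self])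
    show "(\<lambda>\<omega>. w \<omega> * norm (Y \<omega> + c *\<^sub>R Z \<omega>)) \<in> borel_measurable M"
      using w_measurable_M measurable_F_M[OF order_refl m] by simp
  qed
  fix X b assume X: "X \<in> \<A>" "\<forall>\<omega>. norm (X \<omega>) \<le> b * w \<omega>"
  have int: "integrable M (\<lambda>\<omega>. X \<omega> \<bullet> V \<omega>)" if "V \<in> dual_densities" for V
    using X(2) by (intro dual_densities_inner_integrable[OF that attainable_measurable[OF X(1)]]) blast
  have le: "(\<integral>\<omega>. X \<omega> \<bullet> V \<omega> \<partial>M) \<le> 0" if "V \<in> dual_densities" for V
    using X(2) by (intro dual_densitiesD(4)[OF that X(1)]) blast
  have "(\<integral>\<omega>. X \<omega> \<bullet> (Y \<omega> + c *\<^sub>R Z \<omega>) \<partial>M) = (\<integral>\<omega>. X \<omega> \<bullet> Y \<omega> \<partial>M) + c * (\<integral>\<omega>. X \<omega> \<bullet> Z \<omega> \<partial>M)"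
    using int[OF Y] int[OF Z] by (simp add: inner_add_right)
  also have "\<dots> \<le> 0" using le[OF Y] mult_nonneg_nonpos[OF c le[OF Z]] by simp
  finally show "(\<integral>\<omega>. X \<omega> \<bullet> (Y \<omega> + c *\<^sub>R Z \<omega>) \<partial>M) \<le> 0" .
qed

lemma dual_densities_zero: "(\<lambda>_. 0) \<in> dual_densities"
  by (simp add: dual_densities_def)

lemma dual_densities_separate:
  assumes "f \<in> borel_measurable (F T)" "\<And>\<omega>. norm (f \<omega>) \<le> b * w \<omega>" "f \<notin> \<A>"
  obtains Z where "Z \<in> dual_densities" "0 < (\<integral>\<omega>. f \<omega> \<bullet> Z \<omega> \<partial>M)"
proof (rule L0_cone_separation[OF prob_space_axioms subalg[OF order_refl] closed_attainable
      attainable_zero attainable_add attainable_scale w_measurable w_ge_1 assms])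
  fix Z assume "Z \<in> borel_measurable (F T)" "integrable M (\<lambda>\<omega>. w \<omega> * norm (Z \<omega>))"
    "0 < (\<integral>\<omega>. f \<omega> \<bullet> Z \<omega> \<partial>M)"
    "\<And>X b. X \<in> \<A> \<Longrightarrow> (\<And>\<omega>. norm (X \<omega>) \<le> b * w \<omega>) \<Longrightarrow> (\<integral>\<omega>. X \<omega> \<bullet> Z \<omega> \<partial>M) \<le> 0"
  thus thesis by (intro that[of Z]) (auto simp: dual_densities_def)
qed

text \<open>As \<open>w\<close> is at least 1, bounded trades are of order \<open>w\<close> and
  hence legitimate test claims.\<close>

lemma dual_densities_trade:
  assumes Z: "Z \<in> dual_densities" and "t \<le> T" "\<xi> \<in> trades M F \<pi> t" and b: "\<And>\<omega>. norm (\<xi> \<omega>) \<le> b"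
  shows "(\<integral>\<omega>. \<xi> \<omega> \<bullet> Z \<omega> \<partial>M) \<le> 0"
proof (rule dual_densitiesD(4)[OF Z trades_attainable[OF assms(2,3)]])
  fix \<omega>
  have "0 \<le> b" using b[of \<omega>] norm_ge_zero[of "\<xi> \<omega>"] by linarith
  hence "b \<le> b * w \<omega>" using mult_left_mono[OF w_ge_1] by fastforce
  thus "norm (\<xi> \<omega>) \<le> b * w \<omega>" using b[of \<omega>] by linarith
qed

lemma dual_densities_nonneg:
  assumes Z: "Z \<in> dual_densities"
  shows "AE \<omega> in M. \<forall>i. 0 \<le> Z \<omega> $ i"
proof -
  have "AE \<omega> in M. 0 \<le> Z \<omega> $ i" for i
  proof -
    have [measurable]: "Z \<in> borel_measurable (F T)" "Z \<in> borel_measurable M"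
      using dual_densitiesD(1,2)[OF Z] by auto
    define B where "B = {\<omega> \<in> space (F T). Z \<omega> $ i < 0}"
    have [measurable]: "B \<in> sets (F T)" unfolding B_def by measurable
    \<comment> \<open>Test trade: discard one unit of asset \<open>i\<close> where its price is
      negative. Its value is the negative part of that price, whose mean is therefore at most
      0.\<close>
    define \<xi> where "\<xi> \<omega> = indicat_real B \<omega> *\<^sub>R (- axis i 1 :: real^'n)" for \<omega>
    have "\<xi> \<in> trades M F \<pi> T"
    proof (rule tradesI)
      show "\<xi> \<in> borel_measurable (F T)" unfolding \<xi>_def by measurable
      show "AE \<omega> in M. \<xi> \<omega> \<in> neg_cone (\<pi> T \<omega>)"
        by (intro AE_I2 nonpos_in_neg_cone) (simp add: \<xi>_def indicator_def axis_def)
    qed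
    moreover have "norm (\<xi> \<omega>) \<le> 1" for \<omega> by (simp add: \<xi>_def indicator_def)
    ultimately have "(\<integral>\<omega>. \<xi> \<omega> \<bullet> Z \<omega> \<partial>M) \<le> 0" by (rule dual_densities_trade[OF Z order_refl])
    moreover have "\<xi> \<omega> \<bullet> Z \<omega> = max 0 (- (Z \<omega> $ i))" if "\<omega> \<in> space M" for \<omega>
      using that by (auto simp: \<xi>_def B_def indicator_def inner_axis' space_F)
    hence "(\<integral>\<omega>. \<xi> \<omega> \<bullet> Z \<omega> \<partial>M) = (\<integral>\<omega>. max 0 (- (Z \<omega> $ i)) \<partial>M)"
      by (intro Bochner_Integration.integral_cong) auto
    moreover have "0 \<le> (\<integral>\<omega>. max 0 (- (Z \<omega> $ i)) \<partial>M)" by (rule integral_nonneg_AE) simp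
    ultimately have "(\<integral>\<omega>. max 0 (- (Z \<omega> $ i)) \<partial>M) = 0" by simp
    moreover have "integrable M (\<lambda>\<omega>. max 0 (- (Z \<omega> $ i)))"
      using integrable_vec_nth[OF dual_densities_integrable[OF Z]] by simp
    ultimately have "AE \<omega> in M. max 0 (- (Z \<omega> $ i)) = 0"
      by (subst (asm) integral_nonneg_eq_0_iff_AE) auto
    thus ?thesis by eventually_elim (simp add: max_def split: if_splits)
  qed
  thus ?thesis by (simp add: AE_all_countable)
qed

text \<open>The witness is a convergent weighted sum of the given densities, which are nonnegative.\<close>

lemma dual_densities_countable:
  assumes Z: "\<And>n::nat. Z n \<in> dual_densities"
  obtains Y where "Y \<in> dual_densities" "AE \<omega> in M. Y \<omega> = 0 \<longrightarrow> (\<forall>n. Z n \<omega> = 0)"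
proof -
  define I where "I n = (\<integral>\<omega>. w \<omega> * norm (Z n \<omega>) \<partial>M)" for n
  \<comment> \<open>Dividing by \<open>1 + I n\<close> brings the weighted means below 1 and avoids
    a zero denominator; the powers of \<open>1/2\<close> make the sum converge.\<close>
  define a where "a n = (1/2) ^ n / (1 + I n)" for n
  have I0: "0 \<le> I n" for n
    unfolding I_def by (intro integral_nonneg_AE AE_I2) (simp add: w_nonneg)
  hence a0: "0 < a n" for n by (simp add: a_def add_pos_nonneg)
  hence an: "0 \<le> a n" for n by (rule less_imp_le)
  have aI: "a n * I n \<le> (1/2) ^ n" for n
    using mult_left_mono[of "I n / (1 + I n)" 1 "(1/2) ^ n"] I0[of n] by (simp add: a_def)
  have int: "integrable M (\<lambda>\<omega>. a n * (w \<omega> * norm (Z n \<omega>)))" for n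
    using dual_densitiesD(3)[OF Z] by simp
  have sumI: "summable (\<lambda>n. a n * I n)"
    by (rule summable_comparison_test'[of "\<lambda>n. (1/2) ^ n" 0])
      (simp_all add: aI an I0)
  have nn: "(\<integral>\<^sup>+\<omega>. ennreal (a n * (w \<omega> * norm (Z n \<omega>))) \<partial>M) = ennreal (a n * I n)" for n
    using nn_integral_eq_integral[OF int[of n]] by (simp add: I_def an w_nonneg)
  \<comment> \<open>The series has finite mean, by exchanging sum and integral of nonnegative terms,
    and is therefore finite almost surely.\<close>
  have sumAE: "AE \<omega> in M. summable (\<lambda>n. a n * (w \<omega> * norm (Z n \<omega>)))"
  proof -
    have meas: "(\<lambda>\<omega>. ennreal (a n * (w \<omega> * norm (Z n \<omega>)))) \<in> borel_measurable M" for n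
      using borel_measurable_integrable[OF int] by simp
    have "(\<integral>\<^sup>+\<omega>. (\<Sum>n. ennreal (a n * (w \<omega> * norm (Z n \<omega>)))) \<partial>M) = (\<Sum>n. ennreal (a n * I n))"
      by (subst nn_integral_suminf[OF meas]) (simp add: nn)
    also have "\<dots> \<noteq> \<infinity>"
      unfolding infinity_ennreal_def
      by (rule ennreal_suminf_neq_top[OF sumI mult_nonneg_nonneg[OF an I0]])
    finally have "AE \<omega> in M. (\<Sum>n. ennreal (a n * (w \<omega> * norm (Z n \<omega>)))) \<noteq> \<infinity>"
      by (intro nn_integral_PInf_AE borel_measurable_suminf_order meas)
    thus ?thesis
      by eventually_elim (rule summable_suminf_not_top, simp_all add: an w_nonneg)
  qed
  define Y where "Y \<omega> = (\<Sum>n. a n *\<^sub>R Z n \<omega>)" for \<omega>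
  have sumZ: "AE \<omega> in M. summable (\<lambda>n. norm (a n *\<^sub>R Z n \<omega>))"
    using sumAE
  proof eventually_elim
    case (elim \<omega>)
    show ?case
    proof (rule summable_comparison_test'[OF elim])
      fix n
      have "a n * norm (Z n \<omega>) \<le> a n * (w \<omega> * norm (Z n \<omega>))"
        using a0[of n] mult_right_mono[OF w_ge_1[of \<omega>] norm_ge_zero[of "Z n \<omega>"]] by simp
      thus "norm (norm (a n *\<^sub>R Z n \<omega>)) \<le> a n * (w \<omega> * norm (Z n \<omega>))"
        using a0[of n] by simp
    qed
  qed
  have YF: "Y \<in> borel_measurable (F T)"
    unfolding Y_def suminf_eq_lim using dual_densitiesD(1)[OF Z]
    by (intro borel_measurable_lim_metric borel_measurable_sum borel_measurable_scaleR) auto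
  have sum_norm: "summable (\<lambda>n. \<integral>\<omega>. norm (a n * (w \<omega> * norm (Z n \<omega>))) \<partial>M)"
    using sumI by (simp add: I_def an w_nonneg)
  show thesis
  proof (rule that[of Y])
    show "Y \<in> dual_densities"
      unfolding dual_densities_def
    proof (intro CollectI conjI ballI allI impI YF)
      have major: "integrable M (\<lambda>\<omega>. \<Sum>n. a n * (w \<omega> * norm (Z n \<omega>)))"
        by (rule integrable_suminf[OF int _ sum_norm]) (use sumAE in \<open>simp add: an w_nonneg\<close>)
      show "integrable M (\<lambda>\<omega>. w \<omega> * norm (Y \<omega>))"
      proof (rule Bochner_Integration.integrable_bound[OF major])
        show "(\<lambda>\<omega>. w \<omega> * norm (Y \<omega>)) \<in> borel_measurable M"
          using w_measurable_M measurable_F_M[OF order_refl YF] by simp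
        show "AE \<omega> in M. norm (w \<omega> * norm (Y \<omega>)) \<le> norm (\<Sum>n. a n * (w \<omega> * norm (Z n \<omega>)))"
          using sumAE sumZ
        proof eventually_elim
          case (elim \<omega>)
          have "w \<omega> * norm (Y \<omega>) \<le> w \<omega> * (\<Sum>n. norm (a n *\<^sub>R Z n \<omega>))"
            unfolding Y_def using w_pos[of \<omega>] summable_norm[OF elim(2)] by simp
          also have "\<dots> = (\<Sum>n. w \<omega> * norm (a n *\<^sub>R Z n \<omega>))"
            by (rule suminf_mult[OF elim(2), symmetric])
          also have "\<dots> = (\<Sum>n. a n * (w \<omega> * norm (Z n \<omega>)))"
            by (simp add: an mult.left_commute)
          finally show ?case using order_trans[OF _ abs_ge_self] by (simp add: w_nonneg)
        qed
      qed
      fix X b assume X: "X \<in> \<A>" "\<forall>\<omega>. norm (X \<omega>) \<le> b * w \<omega>"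
      from X(2) have Xb: "norm (X \<omega>) \<le> b * w \<omega>" for \<omega> by blast
      let ?f = "\<lambda>n \<omega>. a n * (X \<omega> \<bullet> Z n \<omega>)"
      have bd: "norm (?f n \<omega>) \<le> b * (a n * (w \<omega> * norm (Z n \<omega>)))" for n \<omega>
        using mult_left_mono[OF norm_inner_le_weighted[OF Xb[of \<omega>], of "Z n \<omega>"], of "a n"] a0[of n]
        by (simp add: abs_mult mult.left_commute)
      have fi: "integrable M (?f n)" for n
        using dual_densities_inner_integrable[OF Z attainable_measurable[OF X(1)] Xb] by simp
      \<comment> \<open>The bound of order \<open>w\<close> justifies exchanging sum and integral,
        so the sign condition passes from the summands to \<open>Y\<close>.\<close>
      have sums: "(\<lambda>n. integral\<^sup>L M (?f n)) sums (\<integral>\<omega>. (\<Sum>n. ?f n \<omega>) \<partial>M)"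
      proof (rule sums_integral[OF fi])
        show "AE \<omega> in M. summable (\<lambda>n. norm (?f n \<omega>))"
          using sumAE
        proof eventually_elim
          case (elim \<omega>)
          show ?case
            by (rule summable_comparison_test'[OF summable_mult[OF elim, of b]]) (use bd in simp)
        qed
        show "summable (\<lambda>n. \<integral>\<omega>. norm (?f n \<omega>) \<partial>M)"
        proof (rule summable_comparison_test'[OF summable_mult[OF sumI, of b]])
          fix n
          have "(\<integral>\<omega>. norm (?f n \<omega>) \<partial>M) \<le> (\<integral>\<omega>. b * (a n * (w \<omega> * norm (Z n \<omega>))) \<partial>M)"
            by (rule integral_mono) (use fi int bd in auto)
          thus "norm (\<integral>\<omega>. norm (?f n \<omega>) \<partial>M) \<le> b * (a n * I n)"
            by (simp add: I_def)
        qed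
      qed
      have "integral\<^sup>L M (?f n) \<le> 0" for n
        using dual_densitiesD(4)[OF Z[of n] X(1) Xb] a0[of n] by (simp add: mult_le_0_iff)
      from sums_le[OF this sums sums_zero] have "(\<integral>\<omega>. (\<Sum>n. ?f n \<omega>) \<partial>M) \<le> 0" .
      moreover have "(\<integral>\<omega>. (\<Sum>n. ?f n \<omega>) \<partial>M) = (\<integral>\<omega>. X \<omega> \<bullet> Y \<omega> \<partial>M)"
      proof (rule integral_cong_AE)
        show "AE \<omega> in M. (\<Sum>n. ?f n \<omega>) = X \<omega> \<bullet> Y \<omega>"
          using sumZ
        proof eventually_elim
          case (elim \<omega>)
          from bounded_linear.suminf[OF bounded_linear_inner_right summable_norm_cancel[OF elim], of "X \<omega>"]
          show ?case by (simp add: Y_def)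
        qed
        show "(\<lambda>\<omega>. \<Sum>n. ?f n \<omega>) \<in> borel_measurable M"
          using borel_measurable_integrable[OF fi] by (rule borel_measurable_suminf)
        show "(\<lambda>\<omega>. X \<omega> \<bullet> Y \<omega>) \<in> borel_measurable M"
          using attainable_measurable[OF X(1)] measurable_F_M[OF order_refl YF]
          by (rule borel_measurable_inner)
      qed
      ultimately show "(\<integral>\<omega>. X \<omega> \<bullet> Y \<omega> \<partial>M) \<le> 0" by simp
    qed
    have "AE \<omega> in M. \<forall>n i. 0 \<le> Z n \<omega> $ i"
      using dual_densities_nonneg[OF Z] by (subst AE_all_countable) blast
    thus "AE \<omega> in M. Y \<omega> = 0 \<longrightarrow> (\<forall>n. Z n \<omega> = 0)"
      using sumZ
    proof eventually_elim
      case (elim \<omega>)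
      \<comment> \<open>Nonnegative components cannot cancel, so a zero sum forces every term to
        vanish.\<close>
      have "Z n \<omega> $ i = 0" if "Y \<omega> = 0" for n i
      proof -
        have s: "summable (\<lambda>n. a n *\<^sub>R Z n \<omega>)" by (rule summable_norm_cancel[OF elim(2)])
        have "(\<Sum>n. a n * Z n \<omega> $ i) = 0"
          using bounded_linear.suminf[OF bounded_linear_vec_nth s, of i] that by (simp add: Y_def)
        moreover have "summable (\<lambda>n. a n * Z n \<omega> $ i)"
          using bounded_linear.summable[OF bounded_linear_vec_nth s, of i] by simp
        moreover have "0 \<le> a n * Z n \<omega> $ i" for n using a0[of n] elim(1) by simp
        ultimately have "a n * Z n \<omega> $ i = 0" using suminf_eq_zero_iff by blast
        thus ?thesis using a0[of n] by simp
      qed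
      thus ?case by (simp add: vec_eq_iff)
    qed
  qed
qed

end

subsection \<open>Strictly positive densities\<close>

context weighted_market
begin

text \<open>Exhaustion: a density minimizing the probability of its zero set has none, since absence of
  arbitrage provides another density charging that set.\<close>

lemma dual_densities_nonzero:
  obtains Z where "Z \<in> dual_densities" "AE \<omega> in M. Z \<omega> \<noteq> 0"
proof -
  define B where "B Z = {\<omega> \<in> space M. Z \<omega> = 0}" for Z :: "'a \<Rightarrow> real^'n"
  define s where "s = (INF Z\<in>dual_densities. prob (B Z))"
  have BF: "B Z \<in> sets (F T)" if "Z \<in> dual_densities" for Z
  proof -
    have [measurable]: "Z \<in> borel_measurable (F T)" by (rule dual_densitiesD(1)[OF that])
    have "{\<omega> \<in> space (F T). Z \<omega> = 0} \<in> sets (F T)" by measurable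
    thus ?thesis by (simp add: B_def space_F)
  qed
  have BM: "B Z \<in> sets M" if "Z \<in> dual_densities" for Z
    using BF[OF that] subalg[OF order_refl] by (auto simp: subalgebra_def)
  have bdd: "bdd_below ((\<lambda>Z. prob (B Z)) ` dual_densities)"
    by (rule bdd_belowI2[of _ 0]) simp
  have ne: "dual_densities \<noteq> {}" using dual_densities_zero by blast
  have s_le: "s \<le> prob (B Z)" if "Z \<in> dual_densities" for Z
    unfolding s_def by (rule cINF_lower[OF bdd that])
  have "\<exists>Z\<in>dual_densities. prob (B Z) < s + inverse (real (Suc n))" for n
    using cINF_less_iff[OF ne bdd, of "s + inverse (real (Suc n))"] by (simp add: s_def)
  then obtain Z where Z: "\<And>n. Z n \<in> dual_densities" "\<And>n. prob (B (Z n)) < s + inverse (real (Suc n))"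
    by metis
  from Z(1) obtain Y where Y: "Y \<in> dual_densities" and Y0: "AE \<omega> in M. Y \<omega> = 0 \<longrightarrow> (\<forall>n. Z n \<omega> = 0)"
    by (rule dual_densities_countable)
  \<comment> \<open>Almost surely \<open>Y\<close> vanishes only where every \<open>Z n\<close>
    does, so it attains the infimum.\<close>
  have "prob (B Y) \<le> s + inverse (real (Suc n))" for n
  proof -
    have "AE \<omega> in M. \<omega> \<in> B Y \<longrightarrow> \<omega> \<in> B (Z n)"
      using Y0 by eventually_elim (auto simp: B_def)
    hence "prob (B Y) \<le> prob (B (Z n))" by (rule finite_measure_mono_AE[OF _ BM[OF Z(1)]])
    thus ?thesis using Z(2)[of n] by simp
  qed
  moreover have "(\<lambda>n. s + inverse (real (Suc n))) \<longlonglongrightarrow> s + 0"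
    by (intro tendsto_intros LIMSEQ_inverse_real_of_nat)
  ultimately have Ys: "prob (B Y) \<le> s"
    by (intro LIMSEQ_le_const[where X="\<lambda>n. s + inverse (real (Suc n))"]) auto
  \<comment> \<open>One unit of an arbitrary asset on the zero set of \<open>Y\<close>. Once this
    nonnegative claim is shown attainable, absence of arbitrage makes the set null.\<close>
  define f where "f \<omega> = indicat_real (B Y) \<omega> *\<^sub>R (axis undefined 1 :: real^'n)" for \<omega>
  have fF: "f \<in> borel_measurable (F T)"
    unfolding f_def using BF[OF Y] by (intro borel_measurable_scaleR) auto
  have "f \<in> \<A>"
  proof (rule ccontr)
    assume "f \<notin> \<A>"
    moreover have "norm (f \<omega>) \<le> 1 * w \<omega>" for \<omega>
      using w_ge_1[of \<omega>] w_nonneg[of \<omega>] by (simp add: f_def indicator_def)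
    ultimately obtain V where V: "V \<in> dual_densities" "0 < (\<integral>\<omega>. f \<omega> \<bullet> V \<omega> \<partial>M)"
      using dual_densities_separate[OF fF] by metis
    \<comment> \<open>By nonnegativity \<open>W\<close> vanishes only where both \<open>Y\<close>
      and \<open>V\<close> do. As \<open>Y\<close> is minimal, the zero set cannot shrink, so
      \<open>V\<close> vanishes almost surely on it and prices \<open>f\<close> at 0.\<close>
    define W where "W = (\<lambda>\<omega>. Y \<omega> + 1 *\<^sub>R V \<omega>)"
    have W: "W \<in> dual_densities" unfolding W_def by (rule dual_densities_add_scale[OF Y V(1)]) simp
    have W0: "AE \<omega> in M. W \<omega> = 0 \<longrightarrow> Y \<omega> = 0 \<and> V \<omega> = 0"
      using dual_densities_nonneg[OF Y] dual_densities_nonneg[OF V(1)]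
      by eventually_elim (auto simp: W_def vec_eq_iff add_nonneg_eq_0_iff)
    have "AE \<omega> in M. \<omega> \<in> B W \<longrightarrow> \<omega> \<in> B Y"
      using W0 by eventually_elim (auto simp: B_def)
    hence "prob (B Y) = prob (B W \<inter> B Y)"
    proof -
      have "prob (B W) \<le> prob (B W \<inter> B Y)"
        using W0 BM[OF W] BM[OF Y]
        by (intro finite_measure_mono_AE) (auto simp: B_def)
      moreover have "prob (B W \<inter> B Y) \<le> prob (B Y)"
        by (intro finite_measure_mono) (auto simp: BM[OF Y])
      ultimately show ?thesis using Ys s_le[OF W] by linarith
    qed
    hence "prob (B Y - B W) = 0"
      using finite_measure_Diff'[OF BM[OF Y] BM[OF W]] by (simp add: Int_commute)
    hence "AE \<omega> in M. \<omega> \<notin> B Y - B W"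
      using prob_eq_0[of "B Y - B W"] BM[OF Y] BM[OF W] by simp
    hence "AE \<omega> in M. f \<omega> \<bullet> V \<omega> = 0"
      using W0 by eventually_elim (auto simp: f_def indicator_def B_def)
    hence "(\<integral>\<omega>. f \<omega> \<bullet> V \<omega> \<partial>M) = 0" by (rule integral_eq_zero_AE)
    thus False using V(2) by simp
  qed
  moreover have "f \<in> L0_in M (F T) (\<lambda>\<omega>. {x. \<forall>i. 0 \<le> x $ i})"
    using fF by (simp add: L0_in_def f_def axis_def)
  ultimately have "f \<in> L0_in M (F T) (\<lambda>\<omega>. {0})"
    using no_arbitrage unfolding arbitrage_free_def by blast
  hence "AE \<omega> in M. f \<omega> = 0" by (simp add: L0_in_def)
  moreover have "AE \<omega> in M. \<omega> \<in> space M" by (rule AE_space)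
  ultimately have "AE \<omega> in M. Y \<omega> \<noteq> 0"
    by eventually_elim (auto simp: f_def indicator_def B_def axis_eq_0_iff)
  with Y show thesis by (rule that)
qed

section \<open>Conditional expectations of densities as price processes\<close>

lemma dual_densities_cond_exp_terminal:
  assumes Z: "Z \<in> dual_densities"
  shows "AE \<omega> in M. (\<chi> i. real_cond_exp M (F T) (\<lambda>\<omega>'. Z \<omega>' $ i) \<omega>) = Z \<omega>"
proof -
  interpret S: finite_measure_subalgebra M "F T" by (rule finite_measure_subalg[OF order_refl])
  have "AE \<omega> in M. real_cond_exp M (F T) (\<lambda>\<omega>'. Z \<omega>' $ i) \<omega> = Z \<omega> $ i" for i
    by (rule S.real_cond_exp_F_meas[OF integrable_vec_nth[OF dual_densities_integrable[OF Z]]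
          borel_measurable_vec_nth[OF dual_densitiesD(1)[OF Z]]])
  hence "AE \<omega> in M. \<forall>i. real_cond_exp M (F T) (\<lambda>\<omega>'. Z \<omega>' $ i) \<omega> = Z \<omega> $ i"
    by (simp only: AE_all_countable simp_thms)
  thus ?thesis by eventually_elim (simp add: vec_eq_iff)
qed

text \<open>Where the inequality fails, giving up \<open>\<pi> t \<omega> $ i $ j\<close> units of
  asset \<open>i\<close> for one unit of \<open>j\<close> has strictly positive value. The failure
  is an event of \<open>F t\<close>, so this is a trade at date \<open>t\<close>, and its
  nonpositive price makes the event null.\<close>

lemma dual_densities_exchange:
  assumes Z: "Z \<in> dual_densities" and t: "t \<le> T"
  defines "C \<equiv> \<lambda>\<omega>. (\<chi> i. real_cond_exp M (F t) (\<lambda>\<omega>'. Z \<omega>' $ i) \<omega>) :: real^'n"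
  shows "AE \<omega> in M. C \<omega> $ j \<le> \<pi> t \<omega> $ i $ j * C \<omega> $ i"
proof -
  define Zt where "Zt = (\<lambda>t \<omega>. \<chi> i. real_cond_exp M (F t) (\<lambda>\<omega>'. Z \<omega>' $ i) \<omega>)"
  have mart: "vec_martingale M F T Zt"
    unfolding Zt_def by (rule cond_exp_vec_martingale[OF dual_densities_integrable[OF Z]])
  have C: "C = Zt t" by (simp add: C_def Zt_def)
  have [measurable]: "C \<in> borel_measurable (F t)" unfolding C by (rule vec_martingaleD(1)[OF mart t])
  have [measurable]: "C \<in> borel_measurable M" by (rule measurable_F_M[OF t]) measurable
  have [measurable]: "\<pi> t \<in> borel_measurable (F t)" by (rule \<pi>_measurable[OF t])
  have ZT: "AE \<omega> in M. Zt T \<omega> = Z \<omega>"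
    unfolding Zt_def by (rule dual_densities_cond_exp_terminal[OF Z])
  \<comment> \<open>Test trades must be bounded, so the event is cut by the size of the exchange
    rate; countably many null sets are combined at the end.\<close>
  have "AE \<omega> in M. \<not> (\<pi> t \<omega> $ i $ j * C \<omega> $ i < C \<omega> $ j \<and> \<bar>\<pi> t \<omega> $ i $ j\<bar> \<le> real n)" for n :: nat
  proof -
    define B where "B = {\<omega> \<in> space (F t). \<pi> t \<omega> $ i $ j * C \<omega> $ i < C \<omega> $ j \<and> \<bar>\<pi> t \<omega> $ i $ j\<bar> \<le> real n}"
    have [measurable]: "B \<in> sets (F t)" unfolding B_def by measurable
    define \<xi> where "\<xi> \<omega> = indicat_real B \<omega> *\<^sub>R - ((\<pi> t \<omega> $ i $ j) *\<^sub>R axis i 1 - axis j 1 :: real^'n)" for \<omega>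
    have \<xi>F: "\<xi> \<in> borel_measurable (F t)" unfolding \<xi>_def by measurable
    have "(indicat_real B \<omega> *\<^sub>R ((\<pi> t \<omega> $ i $ j) *\<^sub>R axis i 1 - axis j 1)) \<in> solvency_cone (\<pi> t \<omega>)" for \<omega>
      by (intro solvency_cone_scaleR exchange_in_solvency_cone) simp
    hence "\<xi> \<omega> \<in> neg_cone (\<pi> t \<omega>)" for \<omega>
      unfolding \<xi>_def neg_cone_def scaleR_minus_right by blast
    hence "\<xi> \<in> trades M F \<pi> t" by (intro tradesI[OF \<xi>F]) simp
    moreover have bd: "norm (\<xi> \<omega>) \<le> real n + 1" for \<omega>
    proof (cases "\<omega> \<in> B")
      case True
      have "norm (\<xi> \<omega>) = norm ((\<pi> t \<omega> $ i $ j) *\<^sub>R (axis i 1 :: real^'n) - axis j 1)"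
        using True by (simp add: \<xi>_def norm_minus_commute)
      also have "\<dots> \<le> \<bar>\<pi> t \<omega> $ i $ j\<bar> + 1"
        by (rule order_trans[OF norm_triangle_ineq4]) simp
      finally show ?thesis using True by (simp add: B_def)
    qed (simp add: \<xi>_def)
    ultimately have "(\<integral>\<omega>. \<xi> \<omega> \<bullet> Z \<omega> \<partial>M) \<le> 0" by (rule dual_densities_trade[OF Z t])
    moreover have "(\<integral>\<omega>. \<xi> \<omega> \<bullet> Z \<omega> \<partial>M) = (\<integral>\<omega>. \<xi> \<omega> \<bullet> Zt T \<omega> \<partial>M)"
    proof (rule integral_cong_AE)
      show "AE \<omega> in M. \<xi> \<omega> \<bullet> Z \<omega> = \<xi> \<omega> \<bullet> Zt T \<omega>" using ZT by eventually_elim simp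
      show "(\<lambda>\<omega>. \<xi> \<omega> \<bullet> Z \<omega>) \<in> borel_measurable M"
        using measurable_F_M[OF t \<xi>F] dual_densitiesD(2)[OF Z] by (rule borel_measurable_inner)
      show "(\<lambda>\<omega>. \<xi> \<omega> \<bullet> Zt T \<omega>) \<in> borel_measurable M"
        using measurable_F_M[OF t \<xi>F] measurable_F_M[OF order_refl vec_martingaleD(1)[OF mart order_refl]]
        by (rule borel_measurable_inner)
    qed
    moreover have "(\<integral>\<omega>. \<xi> \<omega> \<bullet> Zt T \<omega> \<partial>M) = (\<integral>\<omega>. \<xi> \<omega> \<bullet> C \<omega> \<partial>M)"
      unfolding C by (rule martingale_inner_bounded[OF mart t order_refl \<xi>F bd])
    moreover have eq: "\<xi> \<omega> \<bullet> C \<omega> = indicat_real B \<omega> * (C \<omega> $ j - \<pi> t \<omega> $ i $ j * C \<omega> $ i)" for \<omega>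
      by (simp add: \<xi>_def inner_diff_left inner_axis' algebra_simps)
    moreover have nonneg: "0 \<le> \<xi> \<omega> \<bullet> C \<omega>" for \<omega>
      unfolding eq by (auto simp: indicator_def B_def)
    have "0 \<le> (\<integral>\<omega>. \<xi> \<omega> \<bullet> C \<omega> \<partial>M)" by (rule integral_nonneg_AE) (simp add: nonneg)
    ultimately have "(\<integral>\<omega>. \<xi> \<omega> \<bullet> C \<omega> \<partial>M) = 0" by linarith
    moreover have "integrable M (\<lambda>\<omega>. \<xi> \<omega> \<bullet> C \<omega>)"
      unfolding C by (rule integrable_inner_bounded[OF measurable_F_M[OF t \<xi>F] vec_martingaleD(2)[OF mart t] bd])
    ultimately have "AE \<omega> in M. \<xi> \<omega> \<bullet> C \<omega> = 0"
      by (subst (asm) integral_nonneg_eq_0_iff_AE) (auto simp: nonneg)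
    moreover have "AE \<omega> in M. \<omega> \<in> space M" by (rule AE_space)
    ultimately show ?thesis
      by eventually_elim (auto simp: eq B_def indicator_def space_F[OF t] split: if_splits)
  qed
  hence "AE \<omega> in M. \<forall>n::nat. \<not> (\<pi> t \<omega> $ i $ j * C \<omega> $ i < C \<omega> $ j \<and> \<bar>\<pi> t \<omega> $ i $ j\<bar> \<le> real n)"
    by (simp only: AE_all_countable simp_thms)
  thus ?thesis
    by eventually_elim (meson not_le real_arch_simple)
qed

text \<open>Strict positivity of every component, unlike \<open>Z \<omega> \<noteq> 0\<close>,
  passes to conditional expectations one component at a time. It holds at \<open>T\<close> because
  one positive component and the exchange inequalities with positive rates force all the others to
  be positive.\<close>

lemma dual_densities_consistent_price_process:
  assumes Z: "Z \<in> dual_densities" and nz: "AE \<omega> in M. Z \<omega> \<noteq> 0"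
  shows "consistent_price_process M F T \<pi>
    (\<lambda>t \<omega>. \<chi> i. real_cond_exp M (F t) (\<lambda>\<omega>'. Z \<omega>' $ i) \<omega>)" (is "consistent_price_process _ _ _ _ ?C")
  unfolding consistent_price_process_def
proof (intro conjI allI impI)
  show "vec_martingale M F T ?C"
    by (rule cond_exp_vec_martingale[OF dual_densities_integrable[OF Z]])
  fix t assume t: "t \<le> T"
  interpret S: finite_measure_subalgebra M "F t" by (rule finite_measure_subalg[OF t])
  have exch: "AE \<omega> in M. \<forall>i j. ?C r \<omega> $ j \<le> \<pi> r \<omega> $ i $ j * ?C r \<omega> $ i" if "r \<le> T" for r
    using dual_densities_exchange[OF Z that] by (simp only: AE_all_countable simp_thms)
  have pos: "AE \<omega> in M. \<forall>i. 0 < Z \<omega> $ i"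
    using exch[OF order_refl] dual_densities_cond_exp_terminal[OF Z] dual_densities_nonneg[OF Z] nz AE_space
  proof eventually_elim
    case (elim \<omega>)
    obtain j where j: "0 < Z \<omega> $ j"
      using elim(3,4) by (auto simp: vec_eq_iff less_le)
    show ?case
    proof
      fix i
      have "Z \<omega> $ j \<le> \<pi> T \<omega> $ i $ j * Z \<omega> $ i" using elim(1) unfolding elim(2) by blast
      with j have "0 < \<pi> T \<omega> $ i $ j * Z \<omega> $ i" by linarith
      thus "0 < Z \<omega> $ i" using \<pi>_pos[OF order_refl elim(5), of i j] by (simp add: zero_less_mult_iff)
    qed
  qed
  have "AE \<omega> in M. 0 < ?C t \<omega> $ i" for i
  proof -
    have "AE \<omega> in M. 0 < Z \<omega> $ i" using pos by eventually_elim simp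
    from S.real_cond_exp_gr_c[OF integrable_vec_nth[OF dual_densities_integrable[OF Z]] this]
    show ?thesis by simp
  qed
  hence "AE \<omega> in M. \<forall>i. 0 < ?C t \<omega> $ i" by (simp only: AE_all_countable simp_thms)
  thus "AE \<omega> in M. ?C t \<omega> \<in> polar_cone (neg_cone (\<pi> t \<omega>)) - {0}"
    using exch[OF t]
  proof eventually_elim
    case (elim \<omega>)
    have "?C t \<omega> \<in> polar_cone (neg_cone (\<pi> t \<omega>))"
      by (rule polar_neg_coneI) (use elim in \<open>blast intro: less_imp_le\<close>)+
    moreover have "?C t \<omega> \<noteq> 0" using elim(1) by (metis less_irrefl zero_index)
    ultimately show ?case by blast
  qed
qed

lemma consistent_price_process_separates:
  assumes \<theta>: "\<theta> \<in> borel_measurable (F T)" "\<And>\<omega>. norm (\<theta> \<omega>) \<le> w \<omega>" "\<theta> \<notin> \<A>"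
  obtains Z where "consistent_price_process M F T \<pi> Z" "integrable M (\<lambda>\<omega>. \<theta> \<omega> \<bullet> Z T \<omega>)"
    "0 < (\<integral>\<omega>. \<theta> \<omega> \<bullet> Z T \<omega> \<partial>M)"
proof -
  have \<theta>w: "norm (\<theta> \<omega>) \<le> 1 * w \<omega>" for \<omega> using \<theta>(2) by simp
  obtain Y where Y: "Y \<in> dual_densities" "0 < (\<integral>\<omega>. \<theta> \<omega> \<bullet> Y \<omega> \<partial>M)"
    using dual_densities_separate[OF \<theta>(1) \<theta>w \<theta>(3)] by metis
  obtain V where V: "V \<in> dual_densities" "AE \<omega> in M. V \<omega> \<noteq> 0"
    by (rule dual_densities_nonzero)
  have \<theta>M: "\<theta> \<in> borel_measurable M" by (rule measurable_F_M[OF order_refl \<theta>(1)])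
  have int: "integrable M (\<lambda>\<omega>. \<theta> \<omega> \<bullet> D \<omega>)" if "D \<in> dual_densities" for D
    by (rule dual_densities_inner_integrable[OF that \<theta>M \<theta>w])
  define a b where "a = (\<integral>\<omega>. \<theta> \<omega> \<bullet> Y \<omega> \<partial>M)" and "b = (\<integral>\<omega>. \<theta> \<omega> \<bullet> V \<omega> \<partial>M)"
  \<comment> \<open>\<open>Y\<close> prices \<open>\<theta>\<close> positively but may vanish;
    \<open>V\<close> is almost surely nonzero but may price \<open>\<theta>\<close> negatively. This
    \<open>e\<close> gives \<open>a + e * b = e * (1 + \<bar>b\<bar> + b)\<close>, which is positive
    for either sign of \<open>b\<close>.\<close>
  define e where "e = a / (1 + \<bar>b\<bar>)"
  have e: "0 < e" using Y(2) by (simp add: e_def a_def add_pos_nonneg)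
  define Z where "Z = (\<lambda>\<omega>. Y \<omega> + e *\<^sub>R V \<omega>)"
  have Z: "Z \<in> dual_densities"
    unfolding Z_def by (rule dual_densities_add_scale[OF Y(1) V(1) less_imp_le[OF e]])
  have nz: "AE \<omega> in M. Z \<omega> \<noteq> 0"
    using dual_densities_nonneg[OF Y(1)] dual_densities_nonneg[OF V(1)] V(2)
  proof eventually_elim
    case (elim \<omega>)
    have "V \<omega> $ i = 0" if "Z \<omega> = 0" for i
    proof -
      have "Y \<omega> $ i + e * V \<omega> $ i = 0" using that by (simp add: Z_def vec_eq_iff)
      moreover have "0 \<le> e * V \<omega> $ i" "0 \<le> Y \<omega> $ i" using elim e by simp_all
      ultimately have "e * V \<omega> $ i = 0" by linarith
      thus ?thesis using e by simp
    qed
    thus ?case using elim(3) by (auto simp: vec_eq_iff)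
  qed
  have "a + e * b = e * (1 + \<bar>b\<bar> + b)"
    by (simp add: e_def field_simps)
  also have "\<dots> > 0" using e by (intro mult_pos_pos) linarith+
  finally have "0 < a + e * b" .
  moreover have "(\<integral>\<omega>. \<theta> \<omega> \<bullet> Z \<omega> \<partial>M) = a + e * b"
    using int[OF Y(1)] int[OF V(1)] by (simp add: Z_def a_def b_def inner_add_right)
  ultimately have pos: "0 < (\<integral>\<omega>. \<theta> \<omega> \<bullet> Z \<omega> \<partial>M)" by simp
  define C where "C = (\<lambda>t \<omega>. \<chi> i. real_cond_exp M (F t) (\<lambda>\<omega>'. Z \<omega>' $ i) \<omega>)"
  have C: "consistent_price_process M F T \<pi> C"
    unfolding C_def by (rule dual_densities_consistent_price_process[OF Z nz])
  have CT: "AE \<omega> in M. \<theta> \<omega> \<bullet> Z \<omega> = \<theta> \<omega> \<bullet> C T \<omega>"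
    using dual_densities_cond_exp_terminal[OF Z] unfolding C_def by eventually_elim simp
  have Cm: "(\<lambda>\<omega>. \<theta> \<omega> \<bullet> C T \<omega>) \<in> borel_measurable M"
  proof (rule borel_measurable_inner[OF \<theta>M])
    have "vec_martingale M F T C" using C by (simp add: consistent_price_process_def)
    thus "C T \<in> borel_measurable M"
      using measurable_F_M[OF order_refl] vec_martingaleD(1) by blast
  qed
  show thesis
  proof (rule that[OF C])
    show "integrable M (\<lambda>\<omega>. \<theta> \<omega> \<bullet> C T \<omega>)"
      by (rule integrable_cong_AE_imp[OF int[OF Z] Cm]) (use CT in \<open>eventually_elim, simp\<close>)
    have "(\<integral>\<omega>. \<theta> \<omega> \<bullet> Z \<omega> \<partial>M) = (\<integral>\<omega>. \<theta> \<omega> \<bullet> C T \<omega> \<partial>M)"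
      by (rule integral_cong_AE[OF borel_measurable_integrable[OF int[OF Z]] Cm CT])
    thus "0 < (\<integral>\<omega>. \<theta> \<omega> \<bullet> C T \<omega> \<partial>M)" using pos by simp
  qed
qed

end

theorem theorem4p15:
  fixes M :: "'a measure" and F :: "nat \<Rightarrow> 'a measure" and T :: nat
    and \<pi> :: "nat \<Rightarrow> 'a \<Rightarrow> real^'n^'n" and \<theta> :: "'a \<Rightarrow> real^'n"
  assumes "filtered_prob_space M F T"
    and "bid_ask_process M F T \<pi>"
    and "\<theta> \<in> borel_measurable (F T)"
    and "closedin (L0_topology M (F T)) (attainable M F T \<pi>)"
    and "arbitrage_free M (F T) (attainable M F T \<pi>)"
  shows "((\<exists>\<eta>. self_financing M F T \<pi> \<eta> \<and> (AE \<omega> in M. \<forall>i. \<theta> \<omega> $ i \<le> \<eta> T \<omega> $ i))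
            \<longleftrightarrow> \<theta> \<in> attainable M F T \<pi>) \<and>
         ((\<exists>\<eta>. self_financing M F T \<pi> \<eta> \<and> (AE \<omega> in M. \<forall>i. \<theta> \<omega> $ i \<le> \<eta> T \<omega> $ i))
            \<longleftrightarrow>
          (\<forall>Z. consistent_price_process M F T \<pi> Z \<and>
               integrable M (\<lambda>\<omega>. max 0 (- (\<theta> \<omega> \<bullet> Z T \<omega>)))
            \<longrightarrow> ext_expectation M (\<lambda>\<omega>. \<theta> \<omega> \<bullet> Z T \<omega>) \<le> 0))"
proof -
  interpret bid_ask_market M F T \<pi> by unfold_locales (rule assms)+
  \<comment> \<open>It dominates \<open>\<theta>\<close>, and is at least 1 so that bounded trades
    remain test claims.\<close>
  define w where "w = (\<lambda>\<omega>. 1 + norm (\<theta> \<omega>))"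
  interpret weighted_market M F T \<pi> w
    by unfold_locales (use assms in \<open>simp_all add: w_def\<close>)
  have "\<theta> \<in> \<A> \<longleftrightarrow> (\<forall>Z. consistent_price_process M F T \<pi> Z \<and>
      integrable M (\<lambda>\<omega>. max 0 (- (\<theta> \<omega> \<bullet> Z T \<omega>))) \<longrightarrow> ext_expectation M (\<lambda>\<omega>. \<theta> \<omega> \<bullet> Z T \<omega>) \<le> 0)"
    (is "_ \<longleftrightarrow> ?dual")
  proof
    assume "\<theta> \<in> \<A>"
    thus ?dual by (auto simp: ext_expectation_integrable attainable_inner)
  next
    assume dual: ?dual
    show "\<theta> \<in> \<A>"
    proof (rule ccontr)
      assume "\<theta> \<notin> \<A>"
      moreover have "norm (\<theta> \<omega>) \<le> w \<omega>" for \<omega> by (simp add: w_def)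
      ultimately obtain Z where Z: "consistent_price_process M F T \<pi> Z"
        "integrable M (\<lambda>\<omega>. \<theta> \<omega> \<bullet> Z T \<omega>)" "0 < (\<integral>\<omega>. \<theta> \<omega> \<bullet> Z T \<omega> \<partial>M)"
        using consistent_price_process_separates[OF assms(3)] by metis
      \<comment> \<open>Integrability of the value admits \<open>Z\<close> to the dual condition and
        identifies the extended expectation with the positive integral.\<close>
      have "integrable M (\<lambda>\<omega>. max 0 (- (\<theta> \<omega> \<bullet> Z T \<omega>)))" using Z(2) by simp
      with dual Z show False by (auto simp: ext_expectation_integrable)
    qed
  qed
  with superreplication_iff_attainable[OF assms(3)] show ?thesis by blast
qed

end
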